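(* Any $\le$-amalgamation class $\mathcal D\subseteq\mathcal C$ is equal to $\mathcal C$ or to $\mathcal C_n$ for some $n\ge2$.
   Context: Fix an integer $q\ge2$; $T=T_q$ is the digraph whose vertices are finite sequences over $\{0,\ldots,q-1\}$ with edges $(\bar w,\bar wi)$. Subdigraphs are induced. For a digraph, an $s$-arc ($s\ge0$) from $u_0$ to $u_s$ is a sequence $u_0\ldots u_s$ with each $(u_i,u_{i+1})$ an edge and $u_{i-1}\ne u_{i+1}$ for $0<i<s$; ${\rm desc}^s(u)$ is the set of endpoints of $s$-arcs from $u$, ${\rm desc}(u)=\bigcup_{s\ge0}{\rm desc}^s(u)$, ${\rm desc}(Y)=\bigcup_{y\in Y}{\rm desc}(y)$. $A\le B$ means $A$ is a subdigraph of $B$ with ${\rm desc}_B(a)\subseteq A$ for all $a\in A$; a descendant-closed set is finitely generated if it is ${\rm desc}(Z)$ for finite $Z$. A $\le$-embedding is an embedding $f:A\to B$ with $f(A)\le B$; $\le$-embeddings $f_i:A\to B_i$ are isomorphic if $f_2=h\circ f_1$ for an isomorphism $h:B_1\to B_2$. $\mathcal C$ is the class of digraphs $A$ with ${\rm desc}(a)\cong T$ for all $a\in A$, $A$ finitely generated, and ${\rm desc}(a)\cap{\rm desc}(b)$ finitely generated for all $a,b\in A$. For $n\ge2$, $\mathcal T_n$ is the member of $\mathcal C$ generated by $n$ vertices $x_1,\ldots,x_n$ with ${\rm desc}^1(x_i)={\rm desc}^1(x_j)$ for all $i,j$, and $\mathcal C_n$ is the class of $A\in\mathcal C$ admitting no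 $\le$-embedding of $\mathcal T_n$. A $\le$-amalgamation class is a class $\mathcal D$ of digraphs which (1) consists of countable finitely generated digraphs, is closed under isomorphism and has countably many isomorphism types; (2) is closed under finitely generated descendant-closed subdigraphs; (3) has the $\le$-amalgamation property: for $A,B_1,B_2\in\mathcal D$ and $\le$-embeddings $f_i:A\to B_i$ there are $C\in\mathcal D$ and $\le$-embeddings $g_i:B_i\to C$ with $g_1\circ f_1=g_2\circ f_2$; (4) for all $A,B\in\mathcal D$ has only countably many isomorphism types of $\le$-embeddings $A\to B$.
   Formalization: The class D is additionally assumed to contain a nonempty digraph, since D empty or D consisting only of the empty digraph would be counterexamples; countable digraphs are represented, up to isomorphism, with vertices among the natural numbers. *)

theory Defs
  imports Main "HOL-Library.Countable_Set"
begin

type_synonym 'a dg = "'a set \<times> ('a \<times> 'a) set"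

definition V :: "'a dg \<Rightarrow> 'a set" where "V G = fst G"
definition E :: "'a dg \<Rightarrow> ('a \<times> 'a) set" where "E G = snd G"

definition wf_dg :: "'a dg \<Rightarrow> bool" where
  "wf_dg G \<longleftrightarrow> E G \<subseteq> V G \<times> V G"

definition Tq :: "nat \<Rightarrow> nat list dg" where
  "Tq q = ({w. set w \<subseteq> {0..<q}},
           {(w, w @ [i]) | w i. set w \<subseteq> {0..<q} \<and> i < q})"

text \<open>s-arcs, given as lists u_0 ... u_s (length s+1).\<close>
definition is_arc :: "'a dg \<Rightarrow> 'a list \<Rightarrow> bool" where
  "is_arc G us \<longleftrightarrow> us \<noteq> [] \<and> set us \<subseteq> V G \<and>
     (\<forall>i. Suc i < length us \<longrightarrow> (us ! i, us ! Suc i) \<in> E G) \<and>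
     (\<forall>i. 0 < i \<and> Suc i < length us \<longrightarrow> us ! (i - 1) \<noteq> us ! Suc i)"

definition desc_s :: "'a dg \<Rightarrow> nat \<Rightarrow> 'a \<Rightarrow> 'a set" where
  "desc_s G s u = {last us | us. is_arc G us \<and> hd us = u \<and> length us = Suc s}"

definition desc :: "'a dg \<Rightarrow> 'a \<Rightarrow> 'a set" where
  "desc G u = (\<Union>s. desc_s G s u)"

definition descs :: "'a dg \<Rightarrow> 'a set \<Rightarrow> 'a set" where
  "descs G Y = (\<Union>y\<in>Y. desc G y)"

definition induced :: "'a dg \<Rightarrow> 'a set \<Rightarrow> 'a dg" where
  "induced G S = (S, E G \<inter> (S \<times> S))"

definition subdg :: "'a dg \<Rightarrow> 'a dg \<Rightarrow> bool" where
  "subdg A B \<longleftrightarrow> V A \<subseteq> V B \<and> E A = E B \<inter> (V A \<times> V A)"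

definition le_dg :: "'a dg \<Rightarrow> 'a dg \<Rightarrow> bool" where
  "le_dg A B \<longleftrightarrow> subdg A B \<and> (\<forall>a\<in>V A. desc B a \<subseteq> V A)"

definition fg_set :: "'a dg \<Rightarrow> 'a set \<Rightarrow> bool" where
  "fg_set G S \<longleftrightarrow> (\<exists>Z. finite Z \<and> Z \<subseteq> V G \<and> S = descs G Z)"

definition fingen :: "'a dg \<Rightarrow> bool" where
  "fingen G \<longleftrightarrow> fg_set G (V G)"

definition iso :: "('a \<Rightarrow> 'b) \<Rightarrow> 'a dg \<Rightarrow> 'b dg \<Rightarrow> bool" where
  "iso f A B \<longleftrightarrow> bij_betw f (V A) (V B) \<and>
     (\<forall>x\<in>V A. \<forall>y\<in>V A. (x, y) \<in> E A \<longleftrightarrow> (f x, f y) \<in> E B)"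

definition emb :: "('a \<Rightarrow> 'b) \<Rightarrow> 'a dg \<Rightarrow> 'b dg \<Rightarrow> bool" where
  "emb f A B \<longleftrightarrow> inj_on f (V A) \<and> f ` V A \<subseteq> V B \<and>
     (\<forall>x\<in>V A. \<forall>y\<in>V A. (x, y) \<in> E A \<longleftrightarrow> (f x, f y) \<in> E B)"

definition le_emb :: "('a \<Rightarrow> 'b) \<Rightarrow> 'a dg \<Rightarrow> 'b dg \<Rightarrow> bool" where
  "le_emb f A B \<longleftrightarrow> emb f A B \<and> le_dg (induced B (f ` V A)) B"

text \<open>Isomorphic \<le>-embeddings f1, f2 : A \<rightarrow> B (same target, so h : B \<cong> B).\<close>
definition iso_embs :: "('a \<Rightarrow> 'b) \<Rightarrow> ('a \<Rightarrow> 'b) \<Rightarrow> 'a dg \<Rightarrow> 'b dg \<Rightarrow> bool" where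
  "iso_embs f1 f2 A B \<longleftrightarrow> (\<exists>h. iso h B B \<and> (\<forall>x\<in>V A. f2 x = h (f1 x)))"

text \<open>The class \<C> (countable digraphs are represented with vertices in nat).\<close>
definition classC :: "nat \<Rightarrow> nat dg set" where
  "classC q = {A. wf_dg A \<and>
      (\<forall>a\<in>V A. \<exists>f. iso f (induced A (desc A a)) (Tq q)) \<and>
      fingen A \<and>
      (\<forall>a\<in>V A. \<forall>b\<in>V A. fg_set A (desc A a \<inter> desc A b))}"

definition is_Tn :: "nat \<Rightarrow> nat \<Rightarrow> nat dg \<Rightarrow> bool" where
  "is_Tn q n B \<longleftrightarrow> B \<in> classC q \<and>
     (\<exists>xs. length xs = n \<and> distinct xs \<and> set xs \<subseteq> V B \<and> V B = descs B (set xs) \<and>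
        (\<forall>x\<in>set xs. \<forall>y\<in>set xs. desc_s B 1 x = desc_s B 1 y))"

definition classCn :: "nat \<Rightarrow> nat \<Rightarrow> nat dg set" where
  "classCn q n = {A \<in> classC q. \<not> (\<exists>B f. is_Tn q n B \<and> le_emb f B A)}"

definition amalg_class :: "nat dg set \<Rightarrow> bool" where
  "amalg_class D \<longleftrightarrow>
    \<comment> \<open>(1)\<close>
    (\<forall>A\<in>D. wf_dg A \<and> fingen A) \<and>
    (\<forall>A\<in>D. \<forall>B f. wf_dg B \<and> iso f A (B :: nat dg) \<longrightarrow> B \<in> D) \<and>
    (\<exists>S. countable S \<and> S \<subseteq> D \<and> (\<forall>A\<in>D. \<exists>B\<in>S. \<exists>f. iso f B A)) \<and>
    \<comment> \<open>(2)\<close>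
    (\<forall>B\<in>D. \<forall>A. le_dg A B \<and> fingen A \<longrightarrow> A \<in> D) \<and>
    \<comment> \<open>(3)\<close>
    (\<forall>A\<in>D. \<forall>B1\<in>D. \<forall>B2\<in>D. \<forall>f1 f2. le_emb f1 A B1 \<and> le_emb f2 A B2 \<longrightarrow>
       (\<exists>C\<in>D. \<exists>g1 g2. le_emb g1 B1 C \<and> le_emb g2 B2 C \<and>
          (\<forall>x\<in>V A. g1 (f1 x) = g2 (f2 x)))) \<and>
    \<comment> \<open>(4)\<close>
    (\<forall>A\<in>D. \<forall>B\<in>D. \<exists>F. countable F \<and> (\<forall>f\<in>F. le_emb f A B) \<and>
       (\<forall>f. le_emb f A B \<longrightarrow> (\<exists>f'\<in>F. iso_embs f' f A B)))"

end

theory Submission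
  imports Defs
begin

text \<open>
  Every \<open>A \<in> \<C>\<close> is built from the empty digraph inside itself by two kinds of steps, each passing from
  a finitely generated descendant-closed \<open>U\<close> to a larger one: adjoining a tree \<open>desc x\<close> disjoint from \<open>U\<close>,
  and adjoining one vertex \<open>x\<close> all of whose children lie in \<open>U\<close>. Both preserve membership in \<open>\<D>\<close>.

  A vertex: let \<open>W\<close> be the set of \<open>u \<in> U\<close> with the same children as \<open>x\<close>, and amalgamate \<open>U\<close> with
  \<open>desc (W \<union> {x})\<close>, a copy of \<open>\<T>\<^sub>m\<close> with \<open>m = |W| + 1\<close>, over its part inside \<open>U\<close>. The image of \<open>x\<close> cannot
  fall into \<open>U\<close>, for it would then equal an element of \<open>W\<close>. Hence only \<open>\<T>\<^sub>m \<in> \<D>\<close> is needed.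

  A tree: \<open>U\<close> carries a finite set \<open>Z\<close> with pairwise disjoint \<open>desc z\<close> such that every \<open>desc u\<close> meets
  \<open>desc Z\<close>. As \<open>q \<ge> 2\<close>, the forest \<open>desc Z\<close> embeds into a tree so as to miss some \<open>desc w\<close>; after amalgamating
  \<open>U\<close> with that tree over \<open>desc Z\<close>, the image of \<open>desc w\<close> is disjoint from \<open>U\<close>.

  So \<open>\<D>\<close> is determined by the least \<open>n\<close> with \<open>\<T>\<^sub>n \<notin> \<D>\<close>, if there is one.
\<close>

section \<open>Descendant sets and embeddings\<close>

text \<open>Excluding 2-cycles makes the no-backtracking clause of s-arcs automatic, so descendants
  are simply the reachable vertices. \<open>classC_asym\<close> shows that every member of
  \<open>classC\<close> has this property.\<close>

definition asym_dg :: "'a dg \<Rightarrow> bool" where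
  "asym_dg G \<longleftrightarrow> wf_dg G \<and> (\<forall>x y. (x, y) \<in> E G \<longrightarrow> (y, x) \<notin> E G)"

text \<open>One-step form of descendant closure, on vertex sets; \<open>le_dg_induced\<close> and
  \<open>le_dg_dclosed\<close> translate between it and \<open>le_dg\<close>.\<close>

definition dclosed :: "'a dg \<Rightarrow> 'a set \<Rightarrow> bool" where
  "dclosed G S \<longleftrightarrow> S \<subseteq> V G \<and> (\<forall>x\<in>S. \<forall>y. (x, y) \<in> E G \<longrightarrow> y \<in> S)"

lemma V_induced [simp]: "V (induced G S) = S"
  and E_induced [simp]: "E (induced G S) = E G \<inter> S \<times> S"
  by (simp_all add: V_def E_def induced_def)

lemma dg_eqI: "V G = V H \<Longrightarrow> E G = E H \<Longrightarrow> G = H"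
  by (simp add: V_def E_def prod_eq_iff)

lemma edge_in_V: "wf_dg G \<Longrightarrow> (x, y) \<in> E G \<Longrightarrow> x \<in> V G \<and> y \<in> V G"
  by (auto simp: wf_dg_def)

lemma asym_dg_wf: "asym_dg G \<Longrightarrow> wf_dg G"
  by (simp add: asym_dg_def)

lemma wf_induced: "wf_dg (induced G S)"
  by (auto simp: wf_dg_def)

lemma asym_induced: "asym_dg G \<Longrightarrow> asym_dg (induced G S)"
  by (auto simp: asym_dg_def wf_induced)

lemma induced_V: "wf_dg G \<Longrightarrow> induced G (V G) = G"
  by (rule dg_eqI) (auto simp: wf_dg_def)

lemma induced_induced: "T \<subseteq> S \<Longrightarrow> induced (induced G S) T = induced G T"
  by (rule dg_eqI) auto

section \<open>Descendants as reachability\<close>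

lemma arc_rtrancl:
  assumes "is_arc G us" "i < length us"
  shows "(hd us, us ! i) \<in> (E G)\<^sup>*"
  using assms(2)
proof (induction i)
  case 0
  then show ?case by (simp add: hd_conv_nth)
next
  case (Suc i)
  then have "(us ! i, us ! Suc i) \<in> E G" using assms(1) by (simp add: is_arc_def)
  with Suc show ?case by (meson Suc_lessD rtrancl.rtrancl_into_rtrancl)
qed

text \<open>Backtracking at the new end would mean that \<open>w\<close> is the predecessor of
  \<open>last us\<close>, giving edges in both directions between the two.\<close>

lemma arc_snoc:
  assumes G: "asym_dg G" and us: "is_arc G us" and e: "(last us, w) \<in> E G"
  shows "is_arc G (us @ [w])"
proof -
  have ne: "us \<noteq> []" and sub: "set us \<subseteq> V G"
    and edges: "\<And>i. Suc i < length us \<Longrightarrow> (us ! i, us ! Suc i) \<in> E G"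
    and nb: "\<And>i. 0 < i \<Longrightarrow> Suc i < length us \<Longrightarrow> us ! (i - 1) \<noteq> us ! Suc i"
    using us by (auto simp: is_arc_def)
  have 1: "((us @ [w]) ! i, (us @ [w]) ! Suc i) \<in> E G" if "Suc i < length (us @ [w])" for i
  proof (cases "Suc i < length us")
    case True
    then show ?thesis using edges[of i] by (simp add: nth_append)
  next
    case False
    then have "i = length us - 1" using that by simp
    then show ?thesis using e ne by (simp add: nth_append last_conv_nth)
  qed
  have 2: "(us @ [w]) ! (i - 1) \<noteq> (us @ [w]) ! Suc i" if "0 < i" "Suc i < length (us @ [w])" for i
  proof (cases "Suc i < length us")
    case True
    moreover from True have "i - 1 < length us" by linarith
    ultimately show ?thesis using nb[of i] that by (simp add: nth_append)
  next
    case False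
    then have i: "i = length us - 1" using that by simp
    have "(us ! (i - 1), us ! i) \<in> E G" using edges[of "i - 1"] that by simp
    moreover have "us ! i = last us" using i ne by (simp add: last_conv_nth)
    ultimately have "us ! (i - 1) \<noteq> w" using e G by (auto simp: asym_dg_def)
    then show ?thesis using i ne that by (simp add: nth_append)
  qed
  show ?thesis
    using sub edge_in_V[OF asym_dg_wf[OF G] e] 1 2 by (simp add: is_arc_def)
qed

lemma mem_desc:
  assumes G: "asym_dg G" and u: "u \<in> V G"
  shows "v \<in> desc G u \<longleftrightarrow> (u, v) \<in> (E G)\<^sup>*"
proof
  assume "v \<in> desc G u"
  then obtain us where us: "is_arc G us" "hd us = u" "last us = v"
    by (auto simp: desc_def desc_s_def)
  then have "us \<noteq> []" by (simp add: is_arc_def)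
  then show "(u, v) \<in> (E G)\<^sup>*"
    using arc_rtrancl[OF us(1), of "length us - 1"] us by (simp add: last_conv_nth)
next
  assume "(u, v) \<in> (E G)\<^sup>*"
  then have "\<exists>us. is_arc G us \<and> hd us = u \<and> last us = v"
  proof (induction rule: rtrancl_induct)
    case base
    show ?case using u by (intro exI[of _ "[u]"]) (simp add: is_arc_def)
  next
    case (step y z)
    then obtain us where us: "is_arc G us" "hd us = u" "last us = y" by blast
    then have "us \<noteq> []" by (simp add: is_arc_def)
    then show ?case using arc_snoc[OF G us(1), of z] us step
      by (intro exI[of _ "us @ [z]"]) simp
  qed
  then obtain us where us: "is_arc G us" "hd us = u" "last us = v" by blast
  then have "length us = Suc (length us - 1)" by (cases us) (auto simp: is_arc_def)
  with us show "v \<in> desc G u" unfolding desc_def desc_s_def by blast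
qed

lemma desc_s_1:
  assumes "wf_dg G"
  shows "desc_s G 1 u = E G `` {u}"
proof
  show "desc_s G 1 u \<subseteq> E G `` {u}"
  proof
    fix v assume "v \<in> desc_s G 1 u"
    then obtain us where us: "is_arc G us" "hd us = u" "last us = v" "length us = Suc (Suc 0)"
      by (auto simp: desc_s_def)
    then obtain a b where "us = [a, b]" by (auto simp: length_Suc_conv)
    with us show "v \<in> E G `` {u}" by (auto simp: is_arc_def)
  qed
  show "E G `` {u} \<subseteq> desc_s G 1 u"
  proof
    fix v assume "v \<in> E G `` {u}"
    then have e: "(u, v) \<in> E G" by simp
    then have "is_arc G [u, v]"
      using edge_in_V[OF assms e] by (auto simp: is_arc_def)
    then show "v \<in> desc_s G 1 u" unfolding desc_s_def by force
  qed
qed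

lemma desc_s_subset: "v \<in> desc_s G s u \<Longrightarrow> v \<in> desc G u"
  by (auto simp: desc_def)

lemma self_in_desc: "u \<in> V G \<Longrightarrow> u \<in> desc G u"
proof -
  assume "u \<in> V G"
  then have "is_arc G [u]" by (simp add: is_arc_def)
  then have "u \<in> desc_s G 0 u" unfolding desc_s_def by force
  then show ?thesis by (rule desc_s_subset)
qed

section \<open>Descendant-closed sets and finite generation\<close>

lemma dclosed_rtrancl:
  assumes "dclosed G S" "x \<in> S" "(x, y) \<in> (E G)\<^sup>*"
  shows "y \<in> S"
  using assms(3,2,1) by (induction rule: rtrancl_induct) (auto simp: dclosed_def)

lemma desc_step:
  assumes "asym_dg G" "u \<in> V G" "v \<in> desc G u" "(v, w) \<in> E G"
  shows "w \<in> desc G u"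
  using assms by (auto simp: mem_desc)

lemma desc_sub_V:
  assumes "asym_dg G" "u \<in> V G"
  shows "desc G u \<subseteq> V G"
proof
  fix v assume "v \<in> desc G u"
  then have "(u, v) \<in> (E G)\<^sup>*" using assms by (simp add: mem_desc)
  then show "v \<in> V G"
    using assms(2) edge_in_V[OF asym_dg_wf[OF assms(1)]] by (induction rule: rtrancl_induct) auto
qed

lemma dclosed_desc: "asym_dg G \<Longrightarrow> u \<in> V G \<Longrightarrow> dclosed G (desc G u)"
  by (simp add: dclosed_def desc_sub_V desc_step)

lemma dclosed_descs: "asym_dg G \<Longrightarrow> X \<subseteq> V G \<Longrightarrow> dclosed G (descs G X)"
  using dclosed_desc[of G] by (simp add: dclosed_def descs_def subset_iff) blast

lemma dclosed_Un: "dclosed G S \<Longrightarrow> dclosed G T \<Longrightarrow> dclosed G (S \<union> T)"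
  by (auto simp: dclosed_def)

lemma dclosed_desc_sub:
  assumes "asym_dg G" "dclosed G S" "x \<in> S"
  shows "desc G x \<subseteq> S"
proof -
  have "x \<in> V G" using assms(2,3) by (auto simp: dclosed_def)
  then show ?thesis using mem_desc[OF assms(1)] dclosed_rtrancl[OF assms(2,3)] by auto
qed

lemma dclosed_descs_sub: "asym_dg G \<Longrightarrow> dclosed G S \<Longrightarrow> X \<subseteq> S \<Longrightarrow> descs G X \<subseteq> S"
  using dclosed_desc_sub[of G S] by (simp add: descs_def subset_iff) blast

lemma desc_trans:
  assumes "asym_dg G" "u \<in> V G" "v \<in> desc G u"
  shows "desc G v \<subseteq> desc G u"
  using dclosed_desc_sub[OF assms(1) dclosed_desc[OF assms(1,2)] assms(3)] .

lemma le_dg_induced: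
  assumes "asym_dg G" "dclosed G S"
  shows "le_dg (induced G S) G"
  using assms dclosed_desc_sub[OF assms] by (auto simp: le_dg_def subdg_def dclosed_def)

lemma le_dg_dclosed:
  assumes "asym_dg G" "le_dg H G"
  shows "dclosed G (V H)" "H = induced G (V H)"
proof -
  have H: "V H \<subseteq> V G" "E H = E G \<inter> V H \<times> V H" "\<And>a. a \<in> V H \<Longrightarrow> desc G a \<subseteq> V H"
    using assms(2) by (auto simp: le_dg_def subdg_def)
  show "dclosed G (V H)"
    unfolding dclosed_def
  proof (intro conjI ballI allI impI)
    fix x y assume "x \<in> V H" "(x, y) \<in> E G"
    then show "y \<in> V H" using H desc_step[OF assms(1) _ self_in_desc] by blast
  qed (use H in auto)
  show "H = induced G (V H)" by (rule dg_eqI) (auto simp: H)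
qed

text \<open>A path that starts in a descendant-closed set never leaves it. Hence descendants can be
  computed in \<open>induced G S\<close> or in \<open>G\<close> alike.\<close>

lemma rtrancl_induced:
  assumes "dclosed G S" "x \<in> S"
  shows "(x, y) \<in> (E (induced G S))\<^sup>* \<longleftrightarrow> (x, y) \<in> (E G)\<^sup>*"
proof
  show "(x, y) \<in> (E (induced G S))\<^sup>* \<Longrightarrow> (x, y) \<in> (E G)\<^sup>*"
    using rtrancl_mono[of "E (induced G S)" "E G"] by auto
next
  assume "(x, y) \<in> (E G)\<^sup>*"
  then show "(x, y) \<in> (E (induced G S))\<^sup>*"
  proof (induction rule: rtrancl_induct)
    case (step y z)
    then have "(y, z) \<in> E (induced G S)"
      using assms dclosed_rtrancl[OF assms] by (auto simp: dclosed_def)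
    with step show ?case by (meson rtrancl.rtrancl_into_rtrancl)
  qed simp
qed

lemma desc_induced:
  assumes "asym_dg G" "dclosed G S" "x \<in> S"
  shows "desc (induced G S) x = desc G x"
  using assms rtrancl_induced[OF assms(2,3)] asym_induced[OF assms(1)]
  by (auto simp: mem_desc dclosed_def)

lemma descs_induced:
  assumes "asym_dg G" "dclosed G S" "X \<subseteq> S"
  shows "descs (induced G S) X = descs G X"
  using desc_induced[OF assms(1,2)] assms(3) by (auto simp: descs_def)

lemma dclosed_induced:
  assumes "dclosed G S" "dclosed G T" "T \<subseteq> S"
  shows "dclosed (induced G S) T"
  using assms by (auto simp: dclosed_def)

text \<open>Each generator is its own descendant, so it lies in \<open>T\<close> and survives the
  restriction to \<open>S\<close>.\<close>

lemma fg_set_induced: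
  assumes G: "asym_dg G" "dclosed G S" and T: "fg_set G T" "T \<subseteq> S"
  shows "fg_set (induced G S) T"
proof -
  obtain Z where Z: "finite Z" "Z \<subseteq> V G" "T = descs G Z" using T by (auto simp: fg_set_def)
  then have "Z \<subseteq> T" using self_in_desc[of _ G] by (auto simp: descs_def)
  then have "Z \<subseteq> S" using T by blast
  with Z show ?thesis using descs_induced[OF G] by (auto simp: fg_set_def)
qed

lemma fg_set_descs: "finite Z \<Longrightarrow> Z \<subseteq> V G \<Longrightarrow> fg_set G (descs G Z)"
  by (auto simp: fg_set_def)

lemma fingen_induced: "asym_dg G \<Longrightarrow> dclosed G S \<Longrightarrow> fg_set G S \<Longrightarrow> fingen (induced G S)"
  by (simp add: fingen_def fg_set_induced)

lemma fg_set_Un: "fg_set G S \<Longrightarrow> fg_set G T \<Longrightarrow> fg_set G (S \<union> T)"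
proof -
  assume "fg_set G S" "fg_set G T"
  then obtain Y Z where "finite Y" "Y \<subseteq> V G" "S = descs G Y" "finite Z" "Z \<subseteq> V G" "T = descs G Z"
    by (auto simp: fg_set_def)
  then show ?thesis using fg_set_descs[of "Y \<union> Z" G] by (simp add: descs_def)
qed

lemma fg_set_UN: "finite I \<Longrightarrow> (\<And>i. i \<in> I \<Longrightarrow> fg_set G (S i)) \<Longrightarrow> fg_set G (\<Union>i\<in>I. S i)"
proof (induction rule: finite_induct)
  case empty
  show ?case using fg_set_descs[of "{}" G] by (simp add: descs_def)
next
  case (insert i I)
  then show ?case by (simp add: fg_set_Un)
qed

lemma fingen_induced_fg_set:
  assumes "asym_dg G" "dclosed G S" "fingen (induced G S)"
  shows "fg_set G S"
proof -
  obtain Z where Z: "finite Z" "Z \<subseteq> S" "S = descs (induced G S) Z"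
    using assms(3) by (auto simp: fingen_def fg_set_def)
  then have "S = descs G Z" using descs_induced[OF assms(1,2)] by simp
  moreover have "Z \<subseteq> V G" using Z assms(2) by (auto simp: dclosed_def)
  ultimately show ?thesis using Z fg_set_descs[of Z G] by simp
qed

section \<open>Isomorphisms and descendant-closed embeddings\<close>

lemma iso_inv:
  assumes "iso f A B"
  shows "iso (inv_into (V A) f) B A"
proof -
  let ?g = "inv_into (V A) f"
  have b: "bij_betw f (V A) (V B)" and e: "\<And>x y. x \<in> V A \<Longrightarrow> y \<in> V A \<Longrightarrow> (x, y) \<in> E A \<longleftrightarrow> (f x, f y) \<in> E B"
    using assms by (simp_all add: iso_def)
  have "?g x \<in> V A" "f (?g x) = x" if "x \<in> V B" for x
    using b that by (simp_all add: bij_betw_def inv_into_into f_inv_into_f)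
  then have "(x, y) \<in> E B \<longleftrightarrow> (?g x, ?g y) \<in> E A" if "x \<in> V B" "y \<in> V B" for x y
    using that by (simp add: e)
  then show ?thesis using bij_betw_inv_into[OF b] by (simp add: iso_def)
qed

lemma iso_comp:
  assumes "iso f A B" "iso g B C"
  shows "iso (g \<circ> f) A C"
proof -
  have "f x \<in> V B" if "x \<in> V A" for x
    using assms(1) that by (auto simp: iso_def bij_betw_def)
  moreover have "bij_betw (g \<circ> f) (V A) (V C)"
    using assms by (auto simp: iso_def intro: bij_betw_trans)
  ultimately show ?thesis using assms by (simp add: iso_def)
qed

lemma iso_emb: "emb f A B \<Longrightarrow> iso f A (induced B (f ` V A))"
  by (auto simp: emb_def iso_def bij_betw_def)

lemma le_emb_induced:
  assumes "asym_dg B" "le_emb f A B"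
  shows "dclosed B (f ` V A)" "emb f A B"
  using assms le_dg_dclosed(1)[OF assms(1), of "induced B (f ` V A)"] by (simp_all add: le_emb_def)

lemma le_embI: "asym_dg B \<Longrightarrow> emb f A B \<Longrightarrow> dclosed B (f ` V A) \<Longrightarrow> le_emb f A B"
  by (simp add: le_emb_def le_dg_induced)

lemma le_emb_inclusion:
  assumes "asym_dg G" "dclosed G S" "dclosed G T" "T \<subseteq> S"
  shows "le_emb id (induced G T) (induced G S)"
  using assms by (intro le_embI) (auto simp: emb_def asym_induced dclosed_induced)

text \<open>As the image is descendant-closed, \<open>f x\<close> acquires no children outside it; a
  plain embedding would only give one inclusion.\<close>

lemma emb_edges:
  assumes "asym_dg B" "wf_dg A" "le_emb f A B" "x \<in> V A"
  shows "E B `` {f x} = f ` (E A `` {x})"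
proof -
  have cl: "\<And>y. (f x, y) \<in> E B \<Longrightarrow> y \<in> f ` V A"
    using le_emb_induced(1)[OF assms(1,3)] assms(4) by (simp add: dclosed_def)
  have e: "\<And>y. y \<in> V A \<Longrightarrow> (x, y) \<in> E A \<longleftrightarrow> (f x, f y) \<in> E B"
    using le_emb_induced(2)[OF assms(1,3)] assms(4) by (simp add: emb_def)
  show ?thesis
  proof
    show "E B `` {f x} \<subseteq> f ` (E A `` {x})"
    proof
      fix y assume "y \<in> E B `` {f x}"
      then have "(f x, y) \<in> E B" by simp
      moreover obtain v where "v \<in> V A" "y = f v" using cl[OF calculation] by blast
      ultimately show "y \<in> f ` (E A `` {x})" using e by simp
    qed
    show "f ` (E A `` {x}) \<subseteq> E B `` {f x}"
      using e edge_in_V[OF assms(2)] by auto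
  qed
qed

lemma emb_desc:
  assumes "asym_dg B" "asym_dg A" "le_emb f A B" "x \<in> V A"
  shows "desc B (f x) = f ` desc A x"
proof
  have fx: "f x \<in> V B" using le_emb_induced(2)[OF assms(1,3)] assms(4) by (auto simp: emb_def)
  note e = emb_edges[OF assms(1) asym_dg_wf[OF assms(2)] assms(3)]
  show "desc B (f x) \<subseteq> f ` desc A x"
  proof
    fix y assume "y \<in> desc B (f x)"
    then have "(f x, y) \<in> (E B)\<^sup>*" by (simp add: mem_desc[OF assms(1) fx])
    then show "y \<in> f ` desc A x"
    proof (induction rule: rtrancl_induct)
      case base
      show ?case using self_in_desc[OF assms(4)] by blast
    next
      case (step y z)
      then obtain u where u: "u \<in> desc A x" "y = f u" by blast
      moreover have "u \<in> V A" using u desc_sub_V[OF assms(2,4)] by blast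
      ultimately obtain v where "(u, v) \<in> E A" "z = f v" using e[of u] step by blast
      then show ?case using u desc_step[OF assms(2,4)] by blast
    qed
  qed
  show "f ` desc A x \<subseteq> desc B (f x)"
  proof
    fix y assume "y \<in> f ` desc A x"
    then obtain u where "(x, u) \<in> (E A)\<^sup>*" "y = f u" by (auto simp: mem_desc[OF assms(2,4)])
    from this(1) have "f u \<in> desc B (f x)"
    proof (induction rule: rtrancl_induct)
      case base
      show ?case using self_in_desc[OF fx] by blast
    next
      case (step u v)
      then have "(f u, f v) \<in> E B" using e[of u] edge_in_V[OF asym_dg_wf[OF assms(2)]] by blast
      then show ?case using step desc_step[OF assms(1) fx] by blast
    qed
    then show "y \<in> desc B (f x)" using \<open>y = f u\<close> by simp
  qed
qed

section \<open>Trees in members of \<open>\<C>\<close>\<close>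

text \<open>The length gives a level function on trees, and \<open>butlast\<close> recovers the
  parent; most of the tree geometry below rests on these two facts.\<close>

lemma Tq_edge: "(u, v) \<in> E (Tq q) \<Longrightarrow> length v = Suc (length u) \<and> butlast v = u"
  by (auto simp: Tq_def E_def)

text \<open>Both ends of a 2-cycle through \<open>a\<close> lie in \<open>desc A a\<close>, and its
  isomorphism with \<open>Tq q\<close> would have to increase word length along both edges.\<close>

lemma classC_asym:
  assumes "A \<in> classC q"
  shows "asym_dg A"
proof -
  have wf: "wf_dg A" using assms by (simp add: classC_def)
  have "(b, a) \<notin> E A" if e: "(a, b) \<in> E A" for a b
  proof
    assume e': "(b, a) \<in> E A"
    have aV: "a \<in> V A" using edge_in_V[OF wf e] by simp
    then obtain f where f: "iso f (induced A (desc A a)) (Tq q)" using assms by (auto simp: classC_def)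
    have "b \<in> desc A a"
      using desc_s_1[OF wf, of a] e desc_s_subset[of b A 1 a] by auto
    then have "(f a, f b) \<in> E (Tq q)" "(f b, f a) \<in> E (Tq q)"
      using f e e' self_in_desc[OF aV] by (auto simp: iso_def)
    from this[THEN Tq_edge] show False by simp
  qed
  then show ?thesis using wf by (auto simp: asym_dg_def)
qed

lemma classC_tree:
  assumes A: "A \<in> classC q" and a: "a \<in> V A"
  obtains f where "iso f (induced A (desc A a)) (Tq q)" "f a = []"
proof -
  note G = classC_asym[OF A]
  obtain f where f: "iso f (induced A (desc A a)) (Tq q)" using A a by (auto simp: classC_def)
  have mono: "length (f a) \<le> length (f v)" if "(a, v) \<in> (E A)\<^sup>*" for v
    using that
  proof (induction rule: rtrancl_induct)
    case (step y z)
    then have "y \<in> desc A a" by (simp add: mem_desc[OF G a])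
    then have "(f y, f z) \<in> E (Tq q)"
      using f step desc_step[OF G a, of y z] by (auto simp: iso_def)
    then show ?case using step Tq_edge by fastforce
  qed simp
  have "[] \<in> V (Tq q)" by (simp add: Tq_def V_def)
  then have "[] \<in> f ` desc A a" using f by (simp add: iso_def bij_betw_def)
  then obtain r where "r \<in> desc A a" "f r = []" by auto
  then have "f a = []" using mono[of r] by (simp add: mem_desc[OF G a])
  with f that show ?thesis by blast
qed

lemma tree_edge:
  assumes "asym_dg A" "a \<in> V A" "iso f (induced A (desc A a)) (Tq q)" "u \<in> desc A a" "(u, v) \<in> E A"
  shows "(f u, f v) \<in> E (Tq q)"
  using assms desc_step[OF assms(1,2,4,5)] by (auto simp: iso_def)

lemma tree_level:
  assumes A: "A \<in> classC q" and a: "a \<in> V A"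
  obtains l :: "nat \<Rightarrow> nat"
  where "l a = 0" "\<And>u v. u \<in> desc A a \<Longrightarrow> (u, v) \<in> E A \<Longrightarrow> l v = Suc (l u)"
proof -
  obtain f where f: "iso f (induced A (desc A a)) (Tq q)" "f a = []" using classC_tree[OF A a] .
  show ?thesis
    using that[of "\<lambda>v. length (f v)"] f Tq_edge[OF tree_edge[OF classC_asym[OF A] a f(1)]] by simp
qed

text \<open>Parents are unique only within one tree \<open>desc A a\<close>; in \<open>A\<close> as
  a whole a vertex may have several, as the common children in \<open>\<T>\<^sub>n\<close>
  do.\<close>

lemma unique_parent:
  assumes A: "A \<in> classC q" and a: "a \<in> V A"
    and u: "u \<in> desc A a" "(u, v) \<in> E A" and u': "u' \<in> desc A a" "(u', v) \<in> E A"
  shows "u = u'"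
proof -
  obtain f where f: "iso f (induced A (desc A a)) (Tq q)" "f a = []" using classC_tree[OF A a] .
  have "f u = f u'"
    using Tq_edge[OF tree_edge[OF classC_asym[OF A] a f(1) u]] Tq_edge[OF tree_edge[OF classC_asym[OF A] a f(1) u']]
    by simp
  then show ?thesis using f(1) u u' by (auto simp: iso_def bij_betw_def dest: inj_onD)
qed

lemma two_children:
  assumes A: "A \<in> classC q" and a: "a \<in> V A" and q: "q \<ge> 2"
  obtains c d where "(a, c) \<in> E A" "(a, d) \<in> E A" "c \<noteq> d"
proof -
  obtain f where f: "iso f (induced A (desc A a)) (Tq q)" "f a = []" using classC_tree[OF A a] .
  have *: "\<exists>c. (a, c) \<in> E A \<and> f c = [i]" if "i < q" for i
  proof -
    have "[i] \<in> V (Tq q)" using that by (simp add: Tq_def V_def)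
    then have "[i] \<in> f ` desc A a" using f by (simp add: iso_def bij_betw_def)
    then obtain c where c: "c \<in> desc A a" "f c = [i]" by auto
    moreover have "([], [i]) \<in> E (Tq q)" using that by (simp add: Tq_def E_def)
    moreover from calculation have "(a, c) \<in> E A" using f self_in_desc[OF a] by (simp add: iso_def)
    ultimately show ?thesis by blast
  qed
  from *[of 0] *[of 1] q obtain c d where "(a, c) \<in> E A" "f c = [0]" "(a, d) \<in> E A" "f d = [1]" by auto
  then show ?thesis using that[of c d] by fastforce
qed

lemma finite_children:
  assumes A: "A \<in> classC q" and a: "a \<in> V A"
  shows "finite (E A `` {a})"
proof -
  obtain f where f: "iso f (induced A (desc A a)) (Tq q)" "f a = []" using classC_tree[OF A a] .
  note G = classC_asym[OF A]
  have sub: "E A `` {a} \<subseteq> desc A a" using desc_step[OF G a self_in_desc[OF a]] by auto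
  have "f ` (E A `` {a}) \<subseteq> (\<lambda>i. [i]) ` {0..<q}"
  proof
    fix w assume "w \<in> f ` (E A `` {a})"
    then obtain c where "(a, c) \<in> E A" "w = f c" by auto
    then have "([], w) \<in> E (Tq q)"
      using tree_edge[OF G a f(1) self_in_desc[OF a], of c] f by simp
    then show "w \<in> (\<lambda>i. [i]) ` {0..<q}" by (auto simp: Tq_def E_def)
  qed
  then have "finite (f ` (E A `` {a}))" using finite_subset by blast
  moreover have "inj_on f (E A `` {a})"
    using f(1) sub by (auto simp: iso_def bij_betw_def intro: inj_on_subset)
  ultimately show ?thesis using finite_imageD by blast
qed

section \<open>Order and disjointness inside a single tree\<close>

lemma classC_acyclic:
  assumes A: "A \<in> classC q" and a: "a \<in> V A"
  shows "(a, a) \<notin> (E A)\<^sup>+"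
proof
  assume "(a, a) \<in> (E A)\<^sup>+"
  obtain l :: "nat \<Rightarrow> nat" where l: "l a = 0"
    "\<And>u v. u \<in> desc A a \<Longrightarrow> (u, v) \<in> E A \<Longrightarrow> l v = Suc (l u)"
    using tree_level[OF A a] by blast
  obtain b where b: "(a, b) \<in> (E A)\<^sup>*" "(b, a) \<in> E A" using \<open>(a, a) \<in> (E A)\<^sup>+\<close> by (meson tranclD2)
  then have "b \<in> desc A a" using mem_desc[OF classC_asym[OF A] a] by simp
  then have "l a = Suc (l b)" using l b by blast
  with l show False by simp
qed

text \<open>Induction along the path from \<open>u\<close> to the common descendant: unless
  \<open>u'\<close> is its last vertex, uniqueness of parents pulls the path from \<open>u'\<close>
  back by one step too.\<close>

lemma ancestors_comparable:
  assumes A: "A \<in> classC q" and a: "a \<in> V A" and u: "u \<in> desc A a" "u' \<in> desc A a"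
    and v: "(u, v) \<in> (E A)\<^sup>*" "(u', v) \<in> (E A)\<^sup>*"
  shows "(u, u') \<in> (E A)\<^sup>* \<or> (u', u) \<in> (E A)\<^sup>*"
  using v
proof (induction rule: rtrancl_induct)
  case (step y z)
  note G = classC_asym[OF A]
  show ?case
  proof (cases "u' = z")
    case True
    then show ?thesis using step.hyps by (meson rtrancl.rtrancl_into_rtrancl)
  next
    case False
    then obtain y' where y': "(u', y') \<in> (E A)\<^sup>*" "(y', z) \<in> E A"
      using step.prems by (meson rtranclE)
    have "y \<in> desc A a" "y' \<in> desc A a"
      using u step.hyps y' by (auto simp: mem_desc[OF G a] intro: rtrancl_trans)
    then have "y' = y" using unique_parent[OF A a _ y'(2) _ step.hyps(2)] by blast
    then show ?thesis using step.IH y' by simp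
  qed
qed simp

text \<open>A common descendant would make the siblings comparable. A path from one to the other
  enters its end through the unique parent \<open>x\<close>, which closes a cycle at
  \<open>x\<close>.\<close>

lemma children_disjoint:
  assumes A: "A \<in> classC q" and c: "(x, c) \<in> E A" "(x, d) \<in> E A" "c \<noteq> d"
  shows "desc A c \<inter> desc A d = {}"
proof (rule ccontr)
  note G = classC_asym[OF A]
  have x: "x \<in> V A" "c \<in> V A" "d \<in> V A" using edge_in_V[OF asym_dg_wf[OF G]] c by auto
  have cd: "c \<in> desc A x" "d \<in> desc A x" using desc_step[OF G x(1) self_in_desc[OF x(1)]] c by auto
  have no: False if c: "(x, c) \<in> E A" "(x, d) \<in> E A" "c \<noteq> d" "(c, d) \<in> (E A)\<^sup>*" for c d
  proof -
    obtain p where p: "(c, p) \<in> (E A)\<^sup>*" "(p, d) \<in> E A" using c(3,4) by (meson rtranclE)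
    have "(x, p) \<in> (E A)\<^sup>*" using p c by (meson converse_rtrancl_into_rtrancl)
    then have "p \<in> desc A x" using mem_desc[OF G x(1)] by simp
    then have "p = x" using unique_parent[OF A x(1) _ p(2) self_in_desc[OF x(1)] c(2)] by blast
    then have "(x, x) \<in> (E A)\<^sup>+" using c(1) p(1) by (meson rtrancl_into_trancl2)
    then show False using classC_acyclic[OF A x(1)] by blast
  qed
  assume "desc A c \<inter> desc A d \<noteq> {}"
  then obtain v where "(c, v) \<in> (E A)\<^sup>*" "(d, v) \<in> (E A)\<^sup>*"
    using mem_desc[OF G x(2)] mem_desc[OF G x(3)] by blast
  then have "(c, d) \<in> (E A)\<^sup>* \<or> (d, c) \<in> (E A)\<^sup>*" using ancestors_comparable[OF A x(1) cd] by blast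
  then show False using no c by blast
qed

lemma classC_induced:
  assumes A: "A \<in> classC q" and S: "dclosed A S" "fg_set A S"
  shows "induced A S \<in> classC q"
proof -
  note G = classC_asym[OF A]
  have SV: "S \<subseteq> V A" using S by (simp add: dclosed_def)
  have d: "desc (induced A S) a = desc A a" "desc A a \<subseteq> S" if "a \<in> S" for a
    using desc_induced[OF G S(1) that] dclosed_desc_sub[OF G S(1) that] by auto
  have "\<exists>f. iso f (induced (induced A S) (desc (induced A S) a)) (Tq q)" if "a \<in> S" for a
    using A SV that by (simp add: d induced_induced) (auto simp: classC_def)
  moreover have "fg_set (induced A S) (desc (induced A S) a \<inter> desc (induced A S) b)"
    if "a \<in> S" "b \<in> S" for a b
  proof -
    have "fg_set A (desc A a \<inter> desc A b)" using A SV that by (auto simp: classC_def)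
    then show ?thesis using that d fg_set_induced[OF G S(1)] by (simp add: le_infI1)
  qed
  ultimately show ?thesis using fingen_induced[OF G S] by (simp add: classC_def wf_induced)
qed

text \<open>Both trees are identified with \<open>Tq q\<close> root to root, which is why
  \<open>f a = b\<close> can be demanded.\<close>

lemma tree_iso:
  assumes A: "A \<in> classC q" "a \<in> V A" and B: "B \<in> classC q" "b \<in> V B"
  obtains f where "iso f (induced A (desc A a)) (induced B (desc B b))" "f a = b"
proof -
  obtain f where f: "iso f (induced A (desc A a)) (Tq q)" "f a = []" using classC_tree[OF A] .
  obtain g where g: "iso g (induced B (desc B b)) (Tq q)" "g b = []" using classC_tree[OF B] .
  let ?g = "inv_into (desc B b) g"
  have "iso (?g \<circ> f) (induced A (desc A a)) (induced B (desc B b))"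
    using iso_comp[OF f(1) iso_inv[OF g(1)]] by simp
  moreover have "?g [] = b"
    using g self_in_desc[OF B(2)] inv_into_f_f[of g "desc B b" b] by (simp add: iso_def bij_betw_def)
  ultimately show ?thesis using that f by simp
qed

text \<open>Of two children of the root, one is kept as an element and the recursion continues below
  the other.\<close>

lemma antichain_exists:
  assumes A: "A \<in> classC q" and t: "t \<in> V A" and q: "q \<ge> 2"
  shows "\<exists>Z. Z \<subseteq> desc A t \<and> finite Z \<and> card Z = m \<and>
    (\<forall>z\<in>Z. \<forall>z'\<in>Z. z \<noteq> z' \<longrightarrow> desc A z \<inter> desc A z' = {})"
  using t
proof (induction m arbitrary: t)
  case 0
  show ?case by (intro exI[of _ "{}"]) simp
next
  case (Suc m)
  note G = classC_asym[OF A]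
  obtain c d where cd: "(t, c) \<in> E A" "(t, d) \<in> E A" "c \<noteq> d" using two_children[OF A Suc.prems q] .
  have V: "c \<in> V A" "d \<in> V A" using edge_in_V[OF asym_dg_wf[OF G]] cd by auto
  obtain Z where Z: "Z \<subseteq> desc A c" "finite Z" "card Z = m"
    "\<forall>z\<in>Z. \<forall>z'\<in>Z. z \<noteq> z' \<longrightarrow> desc A z \<inter> desc A z' = {}"
    using Suc.IH[OF V(1)] by blast
  have dis: "desc A c \<inter> desc A d = {}" using children_disjoint[OF A cd] .
  have "c \<in> desc A t" "d \<in> desc A t" using desc_step[OF G Suc.prems self_in_desc[OF Suc.prems]] cd by auto
  then have "insert d Z \<subseteq> desc A t" using Z desc_trans[OF G Suc.prems] by blast
  moreover have "d \<notin> Z" using Z dis self_in_desc[OF V(2)] by blast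
  moreover have "desc A z \<inter> desc A d = {}" if "z \<in> Z" for z
    using desc_trans[OF G V(1)] Z(1) that dis by blast
  ultimately show ?case using Z by (intro exI[of _ "insert d Z"]) (auto simp: Int_commute)
qed

lemma desc_unfold:
  assumes G: "asym_dg G" and x: "x \<in> V G"
  shows "desc G x = insert x (descs G (E G `` {x}))"
proof -
  have "(x, v) \<in> (E G)\<^sup>* \<longleftrightarrow> v = x \<or> (\<exists>c. (x, c) \<in> E G \<and> (c, v) \<in> (E G)\<^sup>*)" for v
    by (metis converse_rtranclE converse_rtrancl_into_rtrancl rtrancl.rtrancl_refl)
  moreover have "v \<in> desc G c \<longleftrightarrow> (c, v) \<in> (E G)\<^sup>*" if "(x, c) \<in> E G" for c v
    using mem_desc[OF G] edge_in_V[OF asym_dg_wf[OF G] that] by blast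
  ultimately show ?thesis using mem_desc[OF G x] by (auto simp: descs_def)
qed

lemma not_below_child:
  assumes A: "A \<in> classC q" and x: "x \<in> V A"
  shows "x \<notin> descs A (E A `` {x})"
proof
  assume "x \<in> descs A (E A `` {x})"
  then obtain c where c: "(x, c) \<in> E A" "x \<in> desc A c" by (auto simp: descs_def)
  moreover have "c \<in> V A" using edge_in_V[OF asym_dg_wf[OF classC_asym[OF A]] c(1)] by simp
  ultimately have "(c, x) \<in> (E A)\<^sup>*" using mem_desc[OF classC_asym[OF A]] by blast
  then have "(x, x) \<in> (E A)\<^sup>+" using c(1) by (meson rtrancl_into_trancl2)
  then show False using classC_acyclic[OF A x] by blast
qed

section \<open>The digraphs \<open>\<T>\<^sub>n\<close>\<close>

lemma is_TnE:
  assumes "is_Tn q n B"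
  obtains X K where "B \<in> classC q" "finite X" "card X = n" "X \<subseteq> V B" "\<And>x. x \<in> X \<Longrightarrow> E B `` {x} = K"
    "V B = descs B X"
proof -
  obtain xs where xs: "length xs = n" "distinct xs" "set xs \<subseteq> V B" "V B = descs B (set xs)"
    "\<forall>x\<in>set xs. \<forall>y\<in>set xs. desc_s B 1 x = desc_s B 1 y" and B: "B \<in> classC q"
    using assms by (auto simp: is_Tn_def)
  have "\<forall>x\<in>set xs. \<forall>y\<in>set xs. E B `` {x} = E B `` {y}"
    using xs(5) unfolding desc_s_1[OF asym_dg_wf[OF classC_asym[OF B]]] .
  then obtain K where "\<And>x. x \<in> set xs \<Longrightarrow> E B `` {x} = K" by (metis (no_types))
  then show ?thesis using that[of "set xs" K] xs B distinct_card[of xs] by simp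
qed

text \<open>Source of all copies of \<open>\<T>\<^sub>n\<close>: any finite set of vertices with
  common children generates one.\<close>

lemma is_Tn_induced:
  assumes A: "A \<in> classC q" and W: "finite W" "W \<subseteq> V A" "\<And>w. w \<in> W \<Longrightarrow> E A `` {w} = K"
  shows "is_Tn q (card W) (induced A (descs A W))"
proof -
  note G = classC_asym[OF A]
  let ?S = "descs A W"
  have S: "dclosed A ?S" "fg_set A ?S" using dclosed_descs[OF G W(2)] fg_set_descs[OF W(1,2)] .
  have B: "induced A ?S \<in> classC q" using classC_induced[OF A S] .
  obtain xs where xs: "set xs = W" "distinct xs" using finite_distinct_list[OF W(1)] by blast
  have WS: "W \<subseteq> ?S" using self_in_desc[of _ A] W(2) by (auto simp: descs_def)
  have "E (induced A ?S) `` {w} = K" if "w \<in> W" for w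
    using W(3)[OF that] WS that S(1) by (auto simp: dclosed_def)
  then have "desc_s (induced A ?S) 1 w = K" if "w \<in> W" for w
    unfolding desc_s_1[OF wf_induced] using that .
  moreover have "V (induced A ?S) = descs (induced A ?S) W"
    using descs_induced[OF G S(1) WS] by simp
  ultimately show ?thesis
    unfolding is_Tn_def using B xs distinct_card[of xs] WS by (intro conjI exI[of _ xs]) auto
qed

text \<open>Exhibits \<open>\<T>\<^sub>n\<close> as a top layer \<open>X\<close> without incoming
  edges, placed over the forest \<open>descs B K\<close>. Acyclicity separates the two
  layers.\<close>

lemma Tn_decomposition:
  assumes B: "B \<in> classC q" and X: "X \<subseteq> V B" "X \<noteq> {}" and ch: "\<forall>x\<in>X. E B `` {x} = K"
    and gen: "V B = descs B X"
  shows "V B = X \<union> descs B K" "X \<inter> descs B K = {}" "\<And>u v. (u, v) \<in> E B \<Longrightarrow> v \<notin> X"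
proof -
  note G = classC_asym[OF B]
  have d: "desc B x = insert x (descs B K)" if "x \<in> X" for x
    using desc_unfold[OF G, of x] X(1) bspec[OF ch that] that by auto
  then show V: "V B = X \<union> descs B K" using X(2) gen by (auto simp: descs_def)
  show dis: "X \<inter> descs B K = {}" using not_below_child[OF B] X(1) ch by fastforce
  obtain x where x: "x \<in> X" using X(2) by blast
  have K: "K = E B `` {x}" using bspec[OF ch x] by simp
  have KV: "K \<subseteq> V B" unfolding K using edge_in_V[OF asym_dg_wf[OF G]] by auto
  have KK: "K \<subseteq> descs B K" using self_in_desc[of _ B] KV by (auto simp: descs_def)
  show "v \<notin> X" if e: "(u, v) \<in> E B" for u v
  proof -
    have "u \<in> X \<union> descs B K" using edge_in_V[OF asym_dg_wf[OF G] e] V by simp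
    then have "v \<in> descs B K"
    proof
      assume "u \<in> X"
      then have "v \<in> K" using ch e by blast
      then show ?thesis using KK by blast
    next
      assume "u \<in> descs B K"
      then show ?thesis using dclosed_descs[OF G KV] e by (auto simp: dclosed_def)
    qed
    then show ?thesis using dis by blast
  qed
qed

text \<open>\<open>is_Tn\<close> is a property rather than a fixed digraph, so uniqueness has to be
  shown. A tree isomorphism at one generator settles the lower forest; on the generators any
  bijection will do, since all have the same children.\<close>

lemma Tn_iso:
  assumes T: "is_Tn q n B" and T': "is_Tn q n B'" and n: "n \<ge> 1"
  obtains h where "iso h B B'"
proof -
  obtain X K where B: "B \<in> classC q" and X: "finite X" "card X = n" "X \<subseteq> V B"
    "\<And>x. x \<in> X \<Longrightarrow> E B `` {x} = K" "V B = descs B X" using is_TnE[OF T] by metis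
  obtain X' K' where B': "B' \<in> classC q" and X': "finite X'" "card X' = n" "X' \<subseteq> V B'"
    "\<And>x. x \<in> X' \<Longrightarrow> E B' `` {x} = K'" "V B' = descs B' X'" using is_TnE[OF T'] by metis
  have ne: "X \<noteq> {}" "X' \<noteq> {}" using n X X' by auto
  then obtain x x' where x: "x \<in> X" and x': "x' \<in> X'" by blast
  have xV: "x \<in> V B" "x' \<in> V B'" using x x' X X' by auto
  note G = classC_asym[OF B] and G' = classC_asym[OF B']
  let ?Y = "descs B K" and ?Y' = "descs B' K'"
  have ch: "\<forall>x\<in>X. E B `` {x} = K" "\<forall>x\<in>X'. E B' `` {x} = K'" using X(4) X'(4) by blast+
  note D = Tn_decomposition[OF B X(3) ne(1) ch(1) X(5)]
  note D' = Tn_decomposition[OF B' X'(3) ne(2) ch(2) X'(5)]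
  obtain p where p: "iso p (induced B (desc B x)) (induced B' (desc B' x'))" "p x = x'"
    using tree_iso[OF B xV(1) B' xV(2)] .
  have dx: "desc B x = insert x ?Y" using desc_unfold[OF G xV(1)] X(4)[OF x] by simp
  have dx': "desc B' x' = insert x' ?Y'" using desc_unfold[OF G' xV(2)] X'(4)[OF x'] by simp
  have xY: "x \<notin> ?Y" "x' \<notin> ?Y'" using D(2) D'(2) x x' by auto
  have pb: "bij_betw p (insert x ?Y) (insert x' ?Y')" using p(1) dx dx' by (simp add: iso_def)
  have pe: "(u, v) \<in> E B \<longleftrightarrow> (p u, p v) \<in> E B'" if "u \<in> insert x ?Y" "v \<in> insert x ?Y" for u v
  proof -
    have "p u \<in> insert x' ?Y'" "p v \<in> insert x' ?Y'" using bij_betwE[OF pb] that by auto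
    moreover have "(u, v) \<in> E (induced B (insert x ?Y)) \<longleftrightarrow> (p u, p v) \<in> E (induced B' (insert x' ?Y'))"
      using p(1) that unfolding iso_def dx dx' V_induced by blast
    ultimately show ?thesis using that unfolding E_induced by blast
  qed
  \<comment> \<open>Since \<open>p\<close> matches the roots, deleting them leaves a bijection of
    the lower forests.\<close>
  have pY: "bij_betw p ?Y ?Y'"
    using bij_betw_DiffI[OF pb, of "{x}" "{x'}"] p(2) xY by (simp add: bij_betw_def)
  obtain g where g: "bij_betw g X X'" using finite_same_card_bij[OF X(1) X'(1)] X X' by auto
  define h where "h v = (if v \<in> ?Y then p v else g v)" for v
  have hX: "h v = g v" if "v \<in> X" for v using that D(2) by (auto simp: h_def)
  have hY: "h v = p v" if "v \<in> ?Y" for v using that by (auto simp: h_def)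
  have "bij_betw h X X'" using g bij_betw_cong[of X h g X'] hX by simp
  from bij_betw_combine[OF this _ D'(2)] have "bij_betw h ?Y ?Y' \<Longrightarrow> bij_betw h (V B) (V B')"
    unfolding D(1) D'(1) .
  moreover have "bij_betw h ?Y ?Y'" using pY bij_betw_cong[of ?Y h p ?Y'] hY by simp
  ultimately have bij: "bij_betw h (V B) (V B')" by blast
  have "(u, v) \<in> E B \<longleftrightarrow> (h u, h v) \<in> E B'" if "u \<in> V B" "v \<in> V B" for u v
  proof (cases "v \<in> X")
    case True
    then have "h v \<in> X'" using hX bij_betwE[OF g] by simp
    then show ?thesis using True D(3) D'(3) by blast
  next
    case False
    then have v: "v \<in> ?Y" using that D(1) by blast
    show ?thesis
    proof (cases "u \<in> X")
      case True
      then have gu: "g u \<in> X'" using bij_betwE[OF g] by simp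
      \<comment> \<open>The edge is moved to the distinguished generator \<open>x\<close>, the only
        one on which \<open>p\<close> is known, and back from \<open>x'\<close> to
        \<open>g u\<close>.\<close>
      have "(u, v) \<in> E B \<longleftrightarrow> (x, v) \<in> E B" using X(4)[OF True] X(4)[OF x] by blast
      also have "\<dots> \<longleftrightarrow> (x', p v) \<in> E B'" using pe[of x v] v p(2) by simp
      also have "\<dots> \<longleftrightarrow> (g u, p v) \<in> E B'" using X'(4)[OF gu] X'(4)[OF x'] by blast
      finally show ?thesis using hX[OF True] hY[OF v] by simp
    next
      case False
      then have u: "u \<in> ?Y" using that D(1) by blast
      show ?thesis using pe[of u v] u v hY by simp
    qed
  qed
  then have "iso h B B'" using bij by (simp add: iso_def)
  then show ?thesis using that by blast
qed

section \<open>Embeddings of forests\<close>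

text \<open>Disjoint descendant-closed sets have no edges between them, in the domain and in the
  image alike, so the two embeddings need no compatibility.\<close>

lemma le_emb_disjoint_Un:
  assumes A: "asym_dg A" "dclosed A U" "dclosed A S" "U \<inter> S = {}" and C: "asym_dg C"
    and g: "le_emb g (induced A U) C" and k: "le_emb k (induced A S) C" and dis: "g ` U \<inter> k ` S = {}"
  shows "le_emb (\<lambda>v. if v \<in> U then g v else k v) (induced A (U \<union> S)) C"
proof -
  let ?h = "\<lambda>v. if v \<in> U then g v else k v"
  note g' = le_emb_induced[OF C g, simplified] and k' = le_emb_induced[OF C k, simplified]
  have hS: "?h v = k v" if "v \<in> S" for v using that A(4) by auto
  have img: "?h ` (U \<union> S) = g ` U \<union> k ` S" unfolding image_Un by (simp add: hS cong: image_cong)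
  have inj: "inj_on ?h (U \<union> S)"
  proof (rule inj_onI)
    fix u v assume uv: "u \<in> U \<union> S" "v \<in> U \<union> S" "?h u = ?h v"
    have *: "u \<in> U \<longleftrightarrow> v \<in> U" using uv dis hS by (auto split: if_splits)
    show "u = v"
    proof (cases "u \<in> U")
      case True
      then show ?thesis using * uv g'(2) by (auto simp: emb_def dest: inj_onD)
    next
      case False
      then show ?thesis using * uv k'(2) by (auto simp: emb_def dest: inj_onD)
    qed
  qed
  have e: "(u, v) \<in> E A \<longleftrightarrow> (?h u, ?h v) \<in> E C" if uv: "u \<in> U \<union> S" "v \<in> U \<union> S" for u v
  proof -
    consider "u \<in> U" "v \<in> U" | "u \<in> S" "v \<in> S" | "u \<in> U" "v \<in> S" | "u \<in> S" "v \<in> U" using uv by blast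
    then show ?thesis
    proof cases
      case 1
      then show ?thesis using g'(2) by (simp add: emb_def)
    next
      case 2
      then show ?thesis using k'(2) hS[OF 2(1)] hS[OF 2(2)] by (simp add: emb_def)
    next
      case 3
      have "(u, v) \<notin> E A" using 3 A(2,4) by (auto simp: dclosed_def)
      moreover have "(g u, k v) \<notin> E C" using 3 g'(1) dis unfolding dclosed_def by blast
      ultimately show ?thesis using 3 hS[OF 3(2)] by simp
    next
      case 4
      have "(u, v) \<notin> E A" using 4 A(3,4) by (auto simp: dclosed_def)
      moreover have "(k u, g v) \<notin> E C" using 4 k'(1) dis unfolding dclosed_def by blast
      ultimately show ?thesis using 4 hS[OF 4(1)] by simp
    qed
  qed
  have cl: "dclosed C (g ` U \<union> k ` S)" using dclosed_Un[OF g'(1) k'(1)] .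
  have "emb ?h (induced A (U \<union> S)) C"
    unfolding emb_def V_induced img using inj e cl by (auto simp: dclosed_def)
  then show ?thesis using cl img by (intro le_embI[OF C]) (simp_all only: V_induced)
qed

lemma tree_le_emb:
  assumes A: "A \<in> classC q" "a \<in> V A" and B: "B \<in> classC q" "b \<in> V B"
  obtains f where "le_emb f (induced A (desc A a)) B" "f ` desc A a = desc B b"
proof -
  note G = classC_asym[OF B(1)]
  obtain f where f: "iso f (induced A (desc A a)) (induced B (desc B b))" using tree_iso[OF A B] .
  have img: "f ` desc A a = desc B b" using f by (simp add: iso_def bij_betw_def)
  have "emb f (induced A (desc A a)) B"
    using f desc_sub_V[OF G B(2)] by (auto simp: iso_def emb_def bij_betw_def)
  then have "le_emb f (induced A (desc A a)) B"
    using img dclosed_desc[OF G B(2)] by (intro le_embI[OF G]) simp_all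
  then show ?thesis using that img by blast
qed

definition indep :: "'a dg \<Rightarrow> 'a set \<Rightarrow> bool" where
  "indep G Z \<longleftrightarrow> finite Z \<and> Z \<subseteq> V G \<and> (\<forall>z\<in>Z. \<forall>z'\<in>Z. z \<noteq> z' \<longrightarrow> desc G z \<inter> desc G z' = {})"

text \<open>A forest is determined by its number of trees; the embedding is assembled one tree at a
  time with \<open>le_emb_disjoint_Un\<close>.\<close>

lemma forest_le_emb:
  assumes A: "A \<in> classC q" and B: "B \<in> classC q"
    and Z: "indep A Z" and Z': "indep B Z'" and card: "card Z = card Z'"
  shows "\<exists>f. le_emb f (induced A (descs A Z)) B \<and> f ` descs A Z = descs B Z'"
proof -
  have "finite Z" using Z by (simp add: indep_def)
  then show ?thesis using Z Z' card
  proof (induction Z arbitrary: Z' rule: finite_induct)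
    case empty
    then have "Z' = {}" by (simp add: indep_def)
    moreover have "le_emb id (induced A {}) B"
      by (intro le_embI[OF classC_asym[OF B]]) (simp_all add: emb_def dclosed_def)
    ultimately show ?case by (auto simp: descs_def)
  next
    case (insert z Z)
    note G = classC_asym[OF A]
    have "finite Z'" "card Z' = Suc (card Z)" using insert by (auto simp: indep_def)
    then obtain z' where z': "z' \<in> Z'" by fastforce
    let ?Y = "Z' - {z'}"
    have "card Z = card ?Y" using \<open>card Z' = Suc (card Z)\<close> \<open>finite Z'\<close> z' by simp
    moreover have "indep A Z" "indep B ?Y" using insert.prems by (auto simp: indep_def)
    ultimately obtain f where f: "le_emb f (induced A (descs A Z)) B" "f ` descs A Z = descs B ?Y"
      using insert.IH by blast
    have zV: "z \<in> V A" "z' \<in> V B" "Z \<subseteq> V A" using insert.prems z' by (auto simp: indep_def)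
    obtain k where k: "le_emb k (induced A (desc A z)) B" "k ` desc A z = desc B z'"
      using tree_le_emb[OF A zV(1) B zV(2)] .
    have "desc A y \<inter> desc A z = {}" if "y \<in> Z" for y
      using insert.prems(1) insert.hyps that by (auto simp: indep_def)
    then have d: "descs A Z \<inter> desc A z = {}" by (auto simp: descs_def)
    have "desc B y \<inter> desc B z' = {}" if "y \<in> ?Y" for y
      using insert.prems(2) z' that by (auto simp: indep_def)
    then have d': "f ` descs A Z \<inter> k ` desc A z = {}" unfolding f(2) k(2) by (auto simp: descs_def)
    let ?h = "\<lambda>v. if v \<in> descs A Z then f v else k v"
    have "le_emb ?h (induced A (descs A Z \<union> desc A z)) B"
      using le_emb_disjoint_Un[OF G dclosed_descs[OF G zV(3)] dclosed_desc[OF G zV(1)] d classC_asym[OF B] f(1) k(1) d'] .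
    moreover have "descs A Z \<union> desc A z = descs A (insert z Z)" by (auto simp: descs_def)
    moreover have "?h ` (descs A Z \<union> desc A z) = f ` descs A Z \<union> k ` desc A z"
    proof -
      have "?h v = k v" if "v \<in> desc A z" for v using d that by auto
      then show ?thesis unfolding image_Un by (simp cong: image_cong)
    qed
    moreover have "f ` descs A Z \<union> k ` desc A z = descs B Z'"
      unfolding f(2) k(2) using z' by (auto simp: descs_def)
    ultimately show ?case by metis
  qed
qed

section \<open>Amalgamation classes\<close>

locale amalgamation_class =
  fixes q :: nat and D :: "nat dg set"
  assumes q: "q \<ge> 2" and amalg: "amalg_class D" and sub: "D \<subseteq> classC q"
begin

section \<open>Closure properties of \<open>D\<close>\<close>

lemma D_iso:
  assumes "A \<in> D" "wf_dg B" "iso f A B"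
  shows "B \<in> D"
proof -
  have "\<forall>A\<in>D. \<forall>B f. wf_dg B \<and> iso f A B \<longrightarrow> B \<in> D" using amalg unfolding amalg_class_def by (elim conjE)
  from this[rule_format, OF assms(1) conjI[OF assms(2,3)]] show ?thesis .
qed

lemma D_induced:
  assumes "A \<in> D" "dclosed A S" "fg_set A S"
  shows "induced A S \<in> D"
proof -
  have G: "asym_dg A" using assms(1) sub classC_asym by blast
  have "\<forall>B\<in>D. \<forall>A. le_dg A B \<and> fingen A \<longrightarrow> A \<in> D"
    using amalg unfolding amalg_class_def by (elim conjE)
  from this[rule_format, OF assms(1) conjI[OF le_dg_induced[OF G assms(2)] fingen_induced[OF G assms(2,3)]]]
  show ?thesis .
qed

lemma D_amalgamation:
  assumes "A \<in> D" "B1 \<in> D" "B2 \<in> D" "le_emb f1 A B1" "le_emb f2 A B2"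
  obtains C g1 g2 where "C \<in> D" "le_emb g1 B1 C" "le_emb g2 B2 C" "\<And>x. x \<in> V A \<Longrightarrow> g1 (f1 x) = g2 (f2 x)"
proof -
  have "\<forall>A\<in>D. \<forall>B1\<in>D. \<forall>B2\<in>D. \<forall>f1 f2. le_emb f1 A B1 \<and> le_emb f2 A B2 \<longrightarrow>
       (\<exists>C\<in>D. \<exists>g1 g2. le_emb g1 B1 C \<and> le_emb g2 B2 C \<and> (\<forall>x\<in>V A. g1 (f1 x) = g2 (f2 x)))"
    using amalg unfolding amalg_class_def by (elim conjE)
  from this[rule_format, OF assms(1,2,3) conjI[OF assms(4,5)]] show ?thesis using that by blast
qed

text \<open>An amalgam may contain more than the digraph sought; it is enough to embed that digraph
  into it, since the image is a finitely generated descendant-closed part.\<close>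

lemma D_le_emb:
  assumes C: "C \<in> D" and A: "asym_dg A" "fingen A" and f: "le_emb f A C"
  shows "A \<in> D"
proof -
  have G: "asym_dg C" using C sub classC_asym by blast
  obtain Z where Z: "finite Z" "Z \<subseteq> V A" "V A = descs A Z" using A(2) by (auto simp: fingen_def fg_set_def)
  have "f ` V A = descs C (f ` Z)"
    using emb_desc[OF G A(1) f] Z(2) unfolding Z(3) descs_def image_UN by (simp add: subset_iff)
  moreover have "f ` Z \<subseteq> V C" using le_emb_induced(2)[OF G f] Z(2) by (auto simp: emb_def)
  ultimately have "fg_set C (f ` V A)" using fg_set_descs[of "f ` Z" C] Z(1) by simp
  then have "induced C (f ` V A) \<in> D" using D_induced[OF C le_emb_induced(1)[OF G f]] by simp
  then show ?thesis
    using D_iso[OF _ asym_dg_wf[OF A(1)] iso_inv[OF iso_emb[OF le_emb_induced(2)[OF G f]]]] by blast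
qed

text \<open>The vertex step. \<open>Tn\<close> is applied only to \<open>insert x W\<close>, where
  \<open>W\<close> collects the vertices of \<open>U\<close> with the same children as
  \<open>x\<close>.\<close>

lemma D_add_vertex:
  assumes A: "A \<in> classC q" and U: "dclosed A U" "induced A U \<in> D"
    and x: "x \<in> V A" "x \<notin> U" "E A `` {x} \<subseteq> U"
    and Tn: "\<And>W. finite W \<Longrightarrow> W \<noteq> {} \<Longrightarrow> W \<subseteq> V A \<Longrightarrow> (\<And>w. w \<in> W \<Longrightarrow> E A `` {w} = E A `` {x})
      \<Longrightarrow> induced A (descs A W) \<in> D"
  shows "dclosed A (insert x U)" "induced A (insert x U) \<in> D"
proof -
  note G = classC_asym[OF A]
  have UV: "U \<subseteq> V A" using U(1) by (simp add: dclosed_def)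
  show cl: "dclosed A (insert x U)" using U(1) x by (auto simp: dclosed_def)
  have fU: "fg_set A U"
    using U sub fingen_induced_fg_set[OF G U(1)] by (auto simp: classC_def)
  then obtain X where X: "finite X" "X \<subseteq> V A" "U = descs A X" by (auto simp: fg_set_def)
  let ?K = "E A `` {x}"
  define W where "W = {u\<in>U. E A `` {u} = ?K}"
  \<comment> \<open>Any one child of \<open>x\<close> bounds \<open>W\<close>: every member of
    \<open>W\<close> is a parent of \<open>c\<close>, and each of the finitely many trees generating
    \<open>U\<close> contains at most one such parent.\<close>
  obtain c where c: "(x, c) \<in> E A" using two_children[OF A x(1) q] by blast
  have "finite {u \<in> desc A z. (u, c) \<in> E A}" (is "finite ?S") if z: "z \<in> V A" for z
  proof (cases "?S = {}")
    case True
    then show ?thesis by (simp only: finite.emptyI)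
  next
    case False
    then obtain u where u: "u \<in> desc A z" "(u, c) \<in> E A" by blast
    then have "?S \<subseteq> {u}" using unique_parent[OF A z, of _ c u] by blast
    then show ?thesis using finite_subset by blast
  qed
  then have "finite (\<Union>z\<in>X. {u \<in> desc A z. (u, c) \<in> E A})" using X(1,2) by blast
  moreover have "W \<subseteq> (\<Union>z\<in>X. {u \<in> desc A z. (u, c) \<in> E A})"
    using X(3) c by (auto simp: W_def descs_def)
  ultimately have finW: "finite W" using finite_subset by blast
  have WU: "W \<subseteq> U" by (auto simp: W_def)
  \<comment> \<open>\<open>?P\<close> is the base of the amalgamation. It contains the children of
    \<open>x\<close>, so that their images under \<open>g\<close> and \<open>k\<close> agree, and
    all of \<open>W\<close>, so that \<open>x\<close> cannot be identified with a vertex of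
    \<open>U\<close>.\<close>
  let ?P = "descs A (W \<union> ?K)" and ?Q = "descs A (insert x W)"
  have WK: "W \<union> ?K \<subseteq> V A" using WU x(3) UV by blast
  have clP: "dclosed A ?P" using dclosed_descs[OF G WK] .
  have fP: "fg_set A ?P" using fg_set_descs[OF _ WK] finW finite_children[OF A x(1)] by simp
  have WKP: "W \<union> ?K \<subseteq> ?P" using self_in_desc[of _ A] WK unfolding descs_def by blast
  have PU: "?P \<subseteq> U" using dclosed_descs_sub[OF G U(1)] WU x(3) by blast
  have xW: "insert x W \<subseteq> V A" using WU UV x(1) by blast
  have clQ: "dclosed A ?Q" using dclosed_descs[OF G xW] .
  have xQ: "insert x W \<subseteq> ?Q" using self_in_desc[of _ A] xW by (auto simp: descs_def)
  then have KQ: "?K \<subseteq> ?Q" using clQ by (auto simp: dclosed_def)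
  have "W \<union> ?K \<subseteq> ?Q" using xQ KQ by blast
  then have PQ: "?P \<subseteq> ?Q" by (rule dclosed_descs_sub[OF G clQ])
  have "induced A ?Q \<in> D" using finW xW by (intro Tn) (auto simp: W_def)
  moreover have "induced A ?P \<in> D"
    using D_induced[OF U(2) dclosed_induced[OF U(1) clP PU] fg_set_induced[OF G U(1) fP PU]]
    by (simp add: induced_induced[OF PU])
  ultimately obtain C g k where C: "C \<in> D" and g: "le_emb g (induced A U) C" and k: "le_emb k (induced A ?Q) C"
    and gk: "\<And>v. v \<in> ?P \<Longrightarrow> g v = k v"
    using D_amalgamation[OF _ U(2) _ le_emb_inclusion[OF G U(1) clP PU] le_emb_inclusion[OF G clQ clP PQ]]
    by (metis V_induced id_apply)
  have GC: "asym_dg C" using C sub classC_asym by blast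
  note g' = le_emb_induced[OF GC g, simplified] and k' = le_emb_induced[OF GC k, simplified]
  have ginj: "inj_on g U" and kinj: "inj_on k ?Q" using g'(2) k'(2) by (auto simp: emb_def)
  have "E C `` {k x} = k ` (E (induced A ?Q) `` {x})"
    using emb_edges[OF GC wf_induced k, of x] xQ by simp
  also have "E (induced A ?Q) `` {x} = ?K" using KQ xQ by auto
  also have "k ` ?K = g ` ?K" using gk WKP by (auto intro!: image_cong)
  finally have chx: "E C `` {k x} = g ` ?K" .
  have new: "k x \<notin> g ` U"
  proof
    assume "k x \<in> g ` U"
    then obtain u where u: "u \<in> U" "k x = g u" by blast
    have "E C `` {g u} = g ` (E (induced A U) `` {u})" using emb_edges[OF GC wf_induced g, of u] u by simp
    also have "E (induced A U) `` {u} = E A `` {u}" using u U(1) by (auto simp: dclosed_def)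
    finally have "g ` (E A `` {u}) = g ` ?K" using chx u by simp
    moreover have "E A `` {u} \<subseteq> U" using u U(1) by (auto simp: dclosed_def)
    \<comment> \<open>If \<open>k x = g u\<close>, then injectivity of \<open>g\<close> gives
      \<open>u\<close> the same children as \<open>x\<close>. So \<open>u\<close> is in
      \<open>W\<close>, where \<open>g\<close> and \<open>k\<close> agree, and injectivity of
      \<open>k\<close> yields \<open>x = u\<close>.\<close>
    ultimately have "E A `` {u} = ?K" using inj_on_image_eq_iff[OF ginj] x(3) by blast
    then have uW: "u \<in> W" using u by (simp add: W_def)
    then have "k x = k u" using u gk WKP by auto
    then have "x = u" using kinj xQ uW by (auto dest: inj_onD)
    then show False using u x by simp
  qed
  define h where "h v = (if v = x then k x else g v)" for v
  have hU: "h v = g v" if "v \<in> U" for v using that x(2) by (auto simp: h_def)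
  have hx: "h x = k x" by (simp add: h_def)
  have img: "h ` insert x U = insert (k x) (g ` U)" by (simp add: hx hU cong: image_cong)
  have "inj_on h U" using ginj hU by (metis inj_on_cong)
  then have hinj: "inj_on h (insert x U)" using new hx hU by (auto simp: inj_on_insert)
  have clC: "dclosed C (insert (k x) (g ` U))"
  proof -
    have "k x \<in> V C" using k'(2) xQ by (auto simp: emb_def)
    moreover have "y \<in> g ` U" if "(k x, y) \<in> E C" for y using chx that x(3) by blast
    ultimately show ?thesis using g'(1) unfolding dclosed_def by blast
  qed
  have he: "(u, v) \<in> E A \<longleftrightarrow> (h u, h v) \<in> E C" if uv: "u \<in> insert x U" "v \<in> insert x U" for u v
  proof (cases "v = x")
    case True
    have "(u, x) \<notin> E A" using uv U(1) x(2) G by (auto simp: dclosed_def asym_dg_def)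
    moreover have "(h u, k x) \<notin> E C"
    proof (cases "u = x")
      case True
      then show ?thesis using GC hx by (auto simp: asym_dg_def)
    next
      case False
      then show ?thesis using uv hU new g'(1) unfolding dclosed_def by force
    qed
    ultimately show ?thesis using True hx by simp
  next
    case False
    then have v: "v \<in> U" using uv by simp
    show ?thesis
    proof (cases "u = x")
      case True
      have "(x, v) \<in> E A \<longleftrightarrow> g v \<in> g ` ?K" using inj_on_image_mem_iff[OF ginj v x(3)] by simp
      also have "\<dots> \<longleftrightarrow> (k x, g v) \<in> E C" using chx by blast
      finally show ?thesis using True hx hU[OF v] by simp
    next
      case False
      then have u: "u \<in> U" using uv by simp
      then show ?thesis using hU v g'(2) by (simp add: emb_def)
    qed
  qed
  have "emb h (induced A (insert x U)) C"
    unfolding emb_def V_induced img using hinj he clC by (auto simp: dclosed_def)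
  then have "le_emb h (induced A (insert x U)) C"
    using clC img by (intro le_embI[OF GC]) (simp_all only: V_induced)
  moreover have "fingen (induced A (insert x U))"
  proof -
    have "insert x U = U \<union> desc A x"
      using desc_unfold[OF G x(1)] dclosed_descs_sub[OF G U(1) x(3)] by blast
    moreover have "fg_set A (desc A x)" using fg_set_descs[of "{x}" A] x(1) by (simp add: descs_def)
    ultimately show ?thesis using fingen_induced[OF G cl] fg_set_Un[OF fU] by simp
  qed
  ultimately show "induced A (insert x U) \<in> D" using D_le_emb[OF C asym_induced[OF G]] by blast
qed

text \<open>The induction invariant. \<open>Z\<close> is a finite test set: a descendant-closed set
  that misses the forest \<open>descs A Z\<close> misses all of \<open>U\<close>.\<close>

definition approximated :: "nat dg \<Rightarrow> nat set \<Rightarrow> bool" where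
  "approximated A U \<longleftrightarrow> dclosed A U \<and> induced A U \<in> D \<and>
    (\<exists>Z. indep A Z \<and> Z \<subseteq> U \<and> (\<forall>u\<in>U. desc A u \<inter> descs A Z \<noteq> {}))"

lemma fg_set_approximated:
  assumes "A \<in> classC q" "approximated A U"
  shows "fg_set A U"
proof -
  have "fingen (induced A U)" using assms(2) sub by (auto simp: approximated_def classC_def)
  then show ?thesis using fingen_induced_fg_set[OF classC_asym[OF assms(1)]] assms(2) by (simp add: approximated_def)
qed

text \<open>The tree step. \<open>B\<close> only supplies a tree in which the forest of
  \<open>Z\<close> and one further disjoint tree have room.\<close>

lemma approximated_add_tree:
  assumes A: "A \<in> classC q" and U: "approximated A U" and x: "x \<in> V A" "desc A x \<inter> U = {}"
    and B: "B \<in> D" "t \<in> V B"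
  shows "approximated A (U \<union> desc A x)"
proof -
  note G = classC_asym[OF A]
  obtain Z where clU: "dclosed A U" and UD: "induced A U \<in> D" and Z: "indep A Z" "Z \<subseteq> U"
    and meets: "\<And>u. u \<in> U \<Longrightarrow> desc A u \<inter> descs A Z \<noteq> {}" using U by (auto simp: approximated_def)
  have BC: "B \<in> classC q" using B sub by blast
  note GB = classC_asym[OF BC]
  \<comment> \<open>One element more than \<open>Z\<close> has: the spare \<open>w\<close> roots the
    tree that stays free.\<close>
  obtain Y where Y: "Y \<subseteq> desc B t" "finite Y" "card Y = Suc (card Z)"
    "\<forall>z\<in>Y. \<forall>z'\<in>Y. z \<noteq> z' \<longrightarrow> desc B z \<inter> desc B z' = {}"
    using antichain_exists[OF BC B(2) q, of "Suc (card Z)"] by (elim exE conjE)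
  have YV: "Y \<subseteq> V B" using Y(1) desc_sub_V[OF GB B(2)] by blast
  obtain w where w: "w \<in> Y" using Y(3) by fastforce
  let ?Y = "Y - {w}" and ?F = "descs A Z"
  have "indep B ?Y" "card Z = card ?Y" using Y YV w by (auto simp: indep_def)
  then obtain f where f: "le_emb f (induced A ?F) B" "f ` ?F = descs B ?Y"
    using forest_le_emb[OF A BC Z(1)] by blast
  have dis: "descs B ?Y \<inter> desc B w = {}" using Y(4) w by (auto simp: descs_def)
  have ZV: "Z \<subseteq> V A" "finite Z" using Z(1) by (auto simp: indep_def)
  have clF: "dclosed A ?F" using dclosed_descs[OF G ZV(1)] .
  have FU: "?F \<subseteq> U" using dclosed_descs_sub[OF G clU Z(2)] .
  have "induced A ?F \<in> D"
    using D_induced[OF UD dclosed_induced[OF clU clF FU] fg_set_induced[OF G clU fg_set_descs[OF ZV(2,1)] FU]]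
    by (simp add: induced_induced[OF FU])
  then obtain C g k where C: "C \<in> D" and g: "le_emb g (induced A U) C" and k: "le_emb k B C"
    and gk: "\<And>v. v \<in> ?F \<Longrightarrow> g v = k (f v)"
    using D_amalgamation[OF _ UD B(1) le_emb_inclusion[OF G clU clF FU] f(1)]
    by (metis V_induced id_apply)
  have CC: "C \<in> classC q" using C sub by blast
  note GC = classC_asym[OF CC]
  have wV: "w \<in> V B" "k w \<in> V C" using w YV le_emb_induced(2)[OF GC k] by (auto simp: emb_def)
  have kinj: "inj_on k (V B)" using le_emb_induced(2)[OF GC k] by (simp add: emb_def)
  have dw: "desc C (k w) = k ` desc B w" using emb_desc[OF GC GB k wV(1)] .
  \<comment> \<open>A vertex \<open>u\<close> with \<open>g u\<close> below \<open>k w\<close> has a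
    descendant in \<open>?F\<close>, whose image would be below both \<open>?Y\<close> and
    \<open>w\<close> in \<open>B\<close>.\<close>
  have new: "g ` U \<inter> desc C (k w) = {}"
  proof (rule ccontr)
    assume "g ` U \<inter> desc C (k w) \<noteq> {}"
    then obtain u where u: "u \<in> U" "g u \<in> desc C (k w)" by blast
    obtain v where v: "v \<in> desc A u" "v \<in> ?F" using meets[OF u(1)] by blast
    have "desc C (g u) = g ` desc A u"
      using emb_desc[OF GC asym_induced[OF G] g] desc_induced[OF G clU] u(1) by simp
    then have "g v \<in> desc C (k w)" using v desc_trans[OF GC wV(2) u(2)] by blast
    then obtain y where y: "y \<in> desc B w" "k (f v) = k y" using dw gk[OF v(2)] by auto
    have fv: "f v \<in> descs B ?Y" using f(2) v(2) by blast
    have "f v \<in> V B" using fv dclosed_descs[OF GB, of ?Y] YV unfolding dclosed_def by blast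
    moreover have "y \<in> V B" using y desc_sub_V[OF GB wV(1)] by blast
    ultimately have "f v = y" using kinj y(2) by (auto dest: inj_onD)
    then show False using fv y(1) dis by blast
  qed
  obtain p where p: "le_emb p (induced A (desc A x)) C" "p ` desc A x = desc C (k w)"
    using tree_le_emb[OF A x(1) CC wV(2)] .
  have Ux: "U \<inter> desc A x = {}" using x(2) by blast
  have cl: "dclosed A (U \<union> desc A x)" using dclosed_Un[OF clU dclosed_desc[OF G x(1)]] .
  have fx: "fg_set A (desc A x)" using fg_set_descs[of "{x}" A] x(1) by (simp add: descs_def)
  have "induced A (U \<union> desc A x) \<in> D"
    using D_le_emb[OF C asym_induced[OF G] fingen_induced[OF G cl fg_set_Un[OF fg_set_approximated[OF A U] fx]]
        le_emb_disjoint_Un[OF G clU dclosed_desc[OF G x(1)] Ux GC g p(1)]] new p(2) by simp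
  moreover have "indep A (insert x Z)"
  proof -
    have "desc A z \<inter> desc A x = {}" if "z \<in> Z" for z
      using dclosed_desc_sub[OF G clU] Z(2) that x(2) by blast
    then show ?thesis using Z(1) x(1) by (auto simp: indep_def Int_commute)
  qed
  moreover have "desc A u \<inter> descs A (insert x Z) \<noteq> {}" if u: "u \<in> U \<union> desc A x" for u
  proof (cases "u \<in> U")
    case True
    then show ?thesis using meets by (auto simp: descs_def)
  next
    case False
    then have "u \<in> desc A x" using u by blast
    moreover from this have "u \<in> desc A u" using self_in_desc[of u A] desc_sub_V[OF G x(1)] by blast
    ultimately show ?thesis by (auto simp: descs_def)
  qed
  ultimately show ?thesis
    unfolding approximated_def using cl Z(2) self_in_desc[OF x(1)] by (intro conjI exI[of _ "insert x Z"]) auto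
qed

text \<open>Induction on the depth \<open>L\<close> below \<open>x\<close> at which every vertex is
  either already in \<open>U\<close> or has a tree disjoint from \<open>U\<close>. At depth 0 the
  tree step applies if anything is missing; otherwise the trees of the children are added first and
  \<open>x\<close> afterwards, by the vertex step.\<close>

lemma approximated_add_desc:
  assumes A: "A \<in> classC q" and B: "B \<in> D" "t \<in> V B"
    and Tn: "\<And>W K. finite W \<Longrightarrow> W \<noteq> {} \<Longrightarrow> W \<subseteq> V A \<Longrightarrow> (\<And>w. w \<in> W \<Longrightarrow> E A `` {w} = K)
      \<Longrightarrow> induced A (descs A W) \<in> D"
  shows "approximated A U \<Longrightarrow> x \<in> V A \<Longrightarrow> (\<And>w. (x, w) \<in> E A ^^ L \<Longrightarrow> w \<in> U \<or> desc A w \<inter> U = {})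
    \<Longrightarrow> approximated A (U \<union> desc A x)"
proof (induction L arbitrary: U x)
  note G = classC_asym[OF A]
  case 0
  then have clU: "dclosed A U" by (simp add: approximated_def)
  from 0(3)[of x] consider "x \<in> U" | "desc A x \<inter> U = {}" by auto
  then show ?case
  proof cases
    case 1
    then have "U \<union> desc A x = U" using dclosed_desc_sub[OF G clU] by blast
    then show ?thesis using 0 by simp
  next
    case 2
    then show ?thesis using approximated_add_tree[OF A 0(1,2) 2 B] by simp
  qed
next
  note G = classC_asym[OF A]
  case (Suc L)
  note U = Suc.prems(1) and x = Suc.prems(2) and lev = Suc.prems(3)
  have clU: "dclosed A U" using U by (simp add: approximated_def)
  show ?case
  proof (cases "x \<in> U")
    case True
    then have "U \<union> desc A x = U" using dclosed_desc_sub[OF G clU] by blast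
    then show ?thesis using U by simp
  next
    case False
    let ?K = "E A `` {x}"
    have KV: "?K \<subseteq> V A" using edge_in_V[OF asym_dg_wf[OF G]] by auto
    \<comment> \<open>The children are treated one after another, so \<open>U\<close> grows in
      between.\<close>
    have step: "approximated A (U \<union> descs A K')" if "finite K'" "K' \<subseteq> ?K" for K'
      using that
    proof (induction K' rule: finite_induct)
      case empty
      then show ?case using U by (simp add: descs_def)
    next
      case (insert c K')
      have c: "(x, c) \<in> E A" "c \<in> V A" using insert.prems KV by auto
      \<comment> \<open>The depth condition survives the growth of \<open>U\<close>, because the
        trees of sibling children are disjoint.\<close>
      have "w \<in> U \<union> descs A K' \<or> desc A w \<inter> (U \<union> descs A K') = {}" if w: "(c, w) \<in> E A ^^ L" for w
      proof -
        have "(x, w) \<in> E A ^^ Suc L" using c w by (meson relpow_Suc_I2)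
        then have 1: "w \<in> U \<or> desc A w \<inter> U = {}" using lev by blast
        have "(c, w) \<in> (E A)\<^sup>*" using w by (meson relpow_imp_rtrancl)
        then have "w \<in> desc A c" using mem_desc[OF G c(2)] by simp
        then have "desc A w \<subseteq> desc A c" using desc_trans[OF G c(2)] by blast
        moreover have "desc A c \<inter> desc A d = {}" if "d \<in> K'" for d
          using children_disjoint[OF A c(1), of d] insert.prems insert.hyps that by blast
        ultimately have "desc A w \<inter> descs A K' = {}" by (auto simp: descs_def)
        with 1 show ?thesis by blast
      qed
      moreover have "approximated A (U \<union> descs A K')" using insert by blast
      ultimately have "approximated A (U \<union> descs A K' \<union> desc A c)" using Suc.IH c(2) by blast
      moreover have "U \<union> descs A K' \<union> desc A c = U \<union> descs A (insert c K')" by (auto simp: descs_def)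
      ultimately show ?case by simp
    qed
    let ?U = "U \<union> descs A ?K"
    have U': "approximated A ?U" using step[OF finite_children[OF A x]] by simp
    have xU: "x \<notin> ?U" using False not_below_child[OF A x] by blast
    have KU: "?K \<subseteq> ?U" using KV self_in_desc[of _ A] by (auto simp: descs_def)
    have eq: "insert x ?U = U \<union> desc A x" using desc_unfold[OF G x] by blast
    have "dclosed A (insert x ?U)" "induced A (insert x ?U) \<in> D"
      using D_add_vertex[OF A _ _ x xU KU] U' Tn unfolding approximated_def by blast+
    \<comment> \<open>The old \<open>Z\<close> still serves: \<open>x\<close> reaches its forest
      through a child.\<close>
    moreover have "\<exists>Z. indep A Z \<and> Z \<subseteq> insert x ?U \<and> (\<forall>u\<in>insert x ?U. desc A u \<inter> descs A Z \<noteq> {})"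
    proof -
      obtain Z where Z: "indep A Z" "Z \<subseteq> ?U" "\<forall>u\<in>?U. desc A u \<inter> descs A Z \<noteq> {}"
        using U' unfolding approximated_def by (elim conjE exE)
      obtain c where c: "c \<in> ?K" using two_children[OF A x q] by blast
      then have "desc A c \<inter> descs A Z \<noteq> {}" using Z(3) KU by blast
      moreover have "desc A c \<subseteq> desc A x" using c desc_unfold[OF G x] by (auto simp: descs_def)
      ultimately have "desc A x \<inter> descs A Z \<noteq> {}" by blast
      with Z show ?thesis by (intro exI[of _ Z]) auto
    qed
    ultimately show ?thesis unfolding approximated_def eq by blast
  qed
qed

text \<open>
  Finite generation of \<open>desc x \<inter> U\<close> is what makes the recursion over the levels below \<open>x\<close> stop.
\<close>

lemma level_resolves:
  assumes A: "A \<in> classC q" and U: "dclosed A U" "fg_set A U" and x: "x \<in> V A"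
  obtains L where "\<And>w. (x, w) \<in> E A ^^ L \<Longrightarrow> w \<in> U \<or> desc A w \<inter> U = {}"
proof -
  note G = classC_asym[OF A]
  obtain X where X: "finite X" "X \<subseteq> V A" "U = descs A X" using U(2) by (auto simp: fg_set_def)
  \<comment> \<open>Intersecting \<open>desc A x\<close> with the generating trees of
    \<open>U\<close> one by one allows the finiteness condition on pairs in \<open>classC\<close> to
    be used.\<close>
  have "fg_set A (\<Union>z\<in>X. desc A x \<inter> desc A z)"
    using A x X(2) by (intro fg_set_UN[OF X(1)]) (auto simp: classC_def)
  moreover have "(\<Union>z\<in>X. desc A x \<inter> desc A z) = desc A x \<inter> U" using X(3) by (auto simp: descs_def)
  ultimately obtain Y where Y: "finite Y" "Y \<subseteq> V A" "desc A x \<inter> U = descs A Y"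
    by (auto simp: fg_set_def)
  obtain l :: "nat \<Rightarrow> nat" where l: "l x = 0"
    "\<And>u v. u \<in> desc A x \<Longrightarrow> (u, v) \<in> E A \<Longrightarrow> l v = Suc (l u)" using tree_level[OF A x] by blast
  have lev: "w \<in> desc A x \<and> l w = n" if "(x, w) \<in> E A ^^ n" for w n
    using that
  proof (induction n arbitrary: w)
    case 0
    then show ?case using l self_in_desc[OF x] by simp
  next
    case (Suc n)
    then obtain v where "(x, v) \<in> E A ^^ n" "(v, w) \<in> E A" by auto
    then show ?case using Suc.IH l(2) desc_step[OF G x] by blast
  qed
  have mono: "v \<in> desc A x \<and> l u \<le> l v" if "u \<in> desc A x" "(u, v) \<in> (E A)\<^sup>*" for u v
    using that(2)
  proof (induction rule: rtrancl_induct)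
    case base
    then show ?case using that(1) by simp
  next
    case (step y z)
    then have "l z = Suc (l y)" "z \<in> desc A x" using l(2) desc_step[OF G x] by blast+
    then show ?case using step by simp
  qed
  \<comment> \<open>\<open>L\<close> bounds the levels of the generators of
    \<open>desc A x \<inter> U\<close>.\<close>
  obtain L where L: "\<forall>y\<in>Y. l y \<le> L"
    using Y(1) finite_nat_set_iff_bounded_le[of "l ` Y"] by auto
  have "w \<in> U" if w: "(x, w) \<in> E A ^^ L" and ne: "desc A w \<inter> U \<noteq> {}" for w
  proof -
    have wx: "w \<in> desc A x" "l w = L" using lev[OF w] by auto
    have wV: "w \<in> V A" using wx desc_sub_V[OF G x] by blast
    obtain v where v: "v \<in> desc A w" "v \<in> U" using ne by blast
    have "v \<in> desc A x" using v desc_trans[OF G x wx(1)] by blast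
    then obtain y where y: "y \<in> Y" "v \<in> desc A y" using v Y(3) by (auto simp: descs_def)
    have yV: "y \<in> V A" using y Y(2) by blast
    have "y \<in> descs A Y" using y self_in_desc[OF yV] by (auto simp: descs_def)
    then have yx: "y \<in> desc A x" "y \<in> U" using Y(3) by blast+
    have "(y, v) \<in> (E A)\<^sup>*" "(w, v) \<in> (E A)\<^sup>*" using v y mem_desc[OF G yV] mem_desc[OF G wV] by auto
    \<comment> \<open>The tree of \<open>w\<close> meets \<open>U\<close> at \<open>v\<close>, which
      lies below a generator \<open>y\<close>. Being ancestors of \<open>v\<close>, \<open>y\<close>
      and \<open>w\<close> are comparable; \<open>w\<close> strictly above \<open>y\<close> would
      put \<open>y\<close> at a level beyond \<open>L\<close>.\<close>
    then consider "(y, w) \<in> (E A)\<^sup>*" | "(w, y) \<in> (E A)\<^sup>*" "w \<noteq> y"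
      using ancestors_comparable[OF A x yx(1) wx(1)] by blast
    then show ?thesis
    proof cases
      case 1
      then show ?thesis using dclosed_rtrancl[OF U(1) yx(2)] by blast
    next
      case 2
      then obtain p where p: "(w, p) \<in> (E A)\<^sup>*" "(p, y) \<in> E A" by (meson rtranclE)
      then have "p \<in> desc A x" "l w \<le> l p" using mono[OF wx(1)] by auto
      then have "l y > L" using l(2) p(2) wx(2) by fastforce
      then show ?thesis using L y(1) by fastforce
    qed
  qed
  then show ?thesis using that by blast
qed

text \<open>The copies of \<open>\<T>\<^sub>n\<close> found in \<open>A\<close> decide membership.
  The generators of \<open>A\<close> are added one at a time, each with the depth given by
  \<open>level_resolves\<close>; \<open>B\<close> provides the empty start and the trees.\<close>

lemma D_contains:
  assumes A: "A \<in> classC q" and B: "B \<in> D" "t \<in> V B"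
    and Tn: "\<And>W K. finite W \<Longrightarrow> W \<noteq> {} \<Longrightarrow> W \<subseteq> V A \<Longrightarrow> (\<And>w. w \<in> W \<Longrightarrow> E A `` {w} = K)
      \<Longrightarrow> induced A (descs A W) \<in> D"
  shows "A \<in> D"
proof -
  note G = classC_asym[OF A]
  obtain X where X: "finite X" "X \<subseteq> V A" "V A = descs A X"
    using A by (auto simp: classC_def fingen_def fg_set_def)
  have "approximated A (descs A X)" using X(1,2)
  proof (induction X rule: finite_induct)
    case empty
    have "induced B {} \<in> D"
      using D_induced[OF B(1), of "{}"] fg_set_descs[of "{}" B] by (simp add: dclosed_def descs_def)
    moreover have "induced B {} = induced A {}" by (rule dg_eqI) auto
    ultimately show ?case
      unfolding approximated_def by (auto simp: dclosed_def descs_def indep_def intro!: exI[of _ "{}"])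
  next
    case (insert x X)
    then have IH: "approximated A (descs A X)" and x: "x \<in> V A" by auto
    have "dclosed A (descs A X)" using IH by (simp add: approximated_def)
    then obtain L where L: "\<And>w. (x, w) \<in> E A ^^ L \<Longrightarrow> w \<in> descs A X \<or> desc A w \<inter> descs A X = {}"
      using level_resolves[OF A _ fg_set_approximated[OF A IH] x] by blast
    have "approximated A (descs A X \<union> desc A x)"
    proof (rule approximated_add_desc[OF A B _ IH x])
      show "induced A (descs A W) \<in> D"
        if "finite W" "W \<noteq> {}" "W \<subseteq> V A" "\<And>w. w \<in> W \<Longrightarrow> E A `` {w} = K" for W K
        using Tn[OF that] .
      show "w \<in> descs A X \<or> desc A w \<inter> descs A X = {}" if "(x, w) \<in> E A ^^ L" for w
        using L[OF that] .
    qed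
    moreover have "descs A X \<union> desc A x = descs A (insert x X)" by (auto simp: descs_def)
    ultimately show ?case by simp
  qed
  then show ?thesis using X(3) induced_V[OF asym_dg_wf[OF G]] by (simp add: approximated_def)
qed

section \<open>Deciding \<open>D\<close> by the \<open>\<T>\<^sub>n\<close> it contains\<close>

lemma D_Tn:
  assumes "is_Tn q n B" "is_Tn q n B'" "n \<ge> 1" "B \<in> D"
  shows "B' \<in> D"
proof -
  obtain h where "iso h B B'" using Tn_iso[OF assms(1-3)] .
  moreover have "wf_dg B'" using assms(2) by (simp add: is_Tn_def classC_def)
  ultimately show ?thesis using D_iso[OF assms(4)] by blast
qed

text \<open>\<open>\<T>\<^sub>1\<close> is a single tree, and the tree below \<open>t\<close> is one
  already in \<open>D\<close>.\<close>

lemma D_T1: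
  assumes B: "B \<in> D" "t \<in> V B" and T: "is_Tn q 1 B'"
  shows "B' \<in> D"
proof -
  have BC: "B \<in> classC q" using B sub by blast
  have t: "dclosed B (descs B {t})" "fg_set B (descs B {t})"
    using dclosed_descs[OF classC_asym[OF BC], of "{t}"] fg_set_descs[of "{t}" B] B(2) by auto
  have "is_Tn q 1 (induced B (descs B {t}))"
    using is_Tn_induced[OF BC, of "{t}" "E B `` {t}"] B(2) by simp
  then show ?thesis using D_Tn[OF _ T] D_induced[OF B(1) t] by simp
qed

theorem classification:
  assumes B: "B \<in> D" "t \<in> V B"
  shows "D = classC q \<or> (\<exists>n\<ge>2. D = classCn q n)"
proof (cases "\<exists>n\<ge>2. \<exists>T. is_Tn q n T \<and> T \<notin> D")
  case False
  have "A \<in> D" if A: "A \<in> classC q" for A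
  proof (rule D_contains[OF A B])
    fix W K assume W: "finite W" "W \<noteq> {}" "W \<subseteq> V A" "\<And>w. w \<in> W \<Longrightarrow> E A `` {w} = K"
    have T: "is_Tn q (card W) (induced A (descs A W))" using is_Tn_induced[OF A W(1,3,4)] .
    have "card W \<ge> 1" using W(1,2) by (simp add: Suc_le_eq card_gt_0_iff)
    then consider "card W = 1" | "card W \<ge> 2" by linarith
    then show "induced A (descs A W) \<in> D"
    proof cases
      case 1
      then show ?thesis using D_T1[OF B] T by simp
    next
      case 2
      then show ?thesis using False T by blast
    qed
  qed
  then show ?thesis using sub by blast
next
  case True
  define n where "n = (LEAST n. n \<ge> 2 \<and> (\<exists>T. is_Tn q n T \<and> T \<notin> D))"
  have n: "n \<ge> 2" "\<exists>T. is_Tn q n T \<and> T \<notin> D"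
    using LeastI_ex[OF True[unfolded Bex_def]] unfolding n_def by blast+
  \<comment> \<open>The least \<open>n\<close> is taken among indices from 2 on, so index 1 needs
    \<open>D_T1\<close> separately.\<close>
  have below: "T \<in> D" if "m \<ge> 1" "m < n" "is_Tn q m T" for m T
  proof (cases "m = 1")
    case True
    then show ?thesis using D_T1[OF B] that by simp
  next
    case False
    then have "m \<ge> 2" using that by simp
    then show ?thesis using not_less_Least[of m] that unfolding n_def by blast
  qed
  \<comment> \<open>By uniqueness up to isomorphism, one copy missing from \<open>D\<close> means
    that all are missing.\<close>
  have notin: "T \<notin> D" if "is_Tn q n T" for T
    using n(2) D_Tn[OF that _ _] n(1) by fastforce
  have "A \<in> classCn q n" if "A \<in> D" for A
  proof -
    have "T \<in> D" if "is_Tn q n T" "le_emb f T A" for T f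
    proof -
      have T: "T \<in> classC q" using that by (simp add: is_Tn_def)
      then have "fingen T" by (simp add: classC_def)
      then show ?thesis using D_le_emb[OF \<open>A \<in> D\<close> classC_asym[OF T] _ that(2)] by blast
    qed
    then show ?thesis using notin that sub unfolding classCn_def by blast
  qed
  moreover have "A \<in> D" if "A \<in> classCn q n" for A
  proof -
    have A: "A \<in> classC q" and no: "\<not> (\<exists>T f. is_Tn q n T \<and> le_emb f T A)"
      using that unfolding classCn_def by blast+
    note G = classC_asym[OF A]
    show ?thesis
    proof (rule D_contains[OF A B])
      fix W K assume W: "finite W" "W \<noteq> {}" "W \<subseteq> V A" "\<And>w. w \<in> W \<Longrightarrow> E A `` {w} = K"
      have T: "is_Tn q (card W) (induced A (descs A W))" using is_Tn_induced[OF A W(1,3,4)] .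
      have c: "card W \<ge> 1" using W(1,2) by (simp add: Suc_le_eq card_gt_0_iff)
      have "card W < n"
      proof (rule ccontr)
        assume "\<not> card W < n"
        \<comment> \<open>Exactly \<open>n\<close> of the vertices of \<open>W\<close> already
          generate a copy of \<open>\<T>\<^sub>n\<close>, which is forbidden in
          \<open>A\<close>.\<close>
        then obtain W' where W': "W' \<subseteq> W" "card W' = n" "finite W'"
          using obtain_subset_with_card_n[of n W] by (metis not_less)
        have W'V: "W' \<subseteq> V A" using W' W by blast
        have "is_Tn q n (induced A (descs A W'))"
          using is_Tn_induced[OF A W'(3) W'V, of K] W' W(4) by blast
        moreover have "le_emb id (induced A (descs A W')) (induced A (V A))"
          using dclosed_descs[OF G W'V] by (intro le_emb_inclusion[OF G]) (auto simp: dclosed_def dest: edge_in_V[OF asym_dg_wf[OF G]])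
        ultimately show False using no induced_V[OF asym_dg_wf[OF G]] by metis
      qed
      then show "induced A (descs A W) \<in> D" using below[OF c _ T] by blast
    qed
  qed
  ultimately have "D = classCn q n" by blast
  then show ?thesis using n(1) by blast
qed

end

text \<open>The nonempty member excludes two degenerate cases that satisfy
  \<open>amalg_class\<close>: the empty class and the class of the empty digraph alone.\<close>

theorem theorem3p8:
  fixes q :: nat and D :: "nat dg set"
  assumes "q \<ge> 2"
    and "amalg_class D"
    and "D \<subseteq> classC q"
    and "\<exists>A\<in>D. V A \<noteq> {}"
  shows "D = classC q \<or> (\<exists>n\<ge>2. D = classCn q n)"
proof -
  interpret amalgamation_class q D using assms(1-3) by unfold_locales
  obtain A t where "A \<in> D" "t \<in> V A" using assms(4) by blast
  then show ?thesis by (rule classification)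
qed

end
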